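(* Let $b\ge1$, $\omega=e^{2\pi i/b}$ and $T(z)=\sum_{n\ge1}n^{n-1}z^n/n!$. Let $B(z,w,q)=\sum_{m\ge0}\sum_{n\ge0}\sum_{k\ge0}B_{m,n,k}w^{bm}\frac{z^n}{n!}q^k$. Then $$B(bz,w,q)=\frac{1-\prod_{j=0}^{b-1}\bigl(1-\frac{T(\omega^jzwq^{1/b})}{z}\bigr)}{\prod_{j=0}^{b-1}\bigl(1-\frac{T(\omega^jzw)}{z}\bigr)}.$$
   Context: A hash table with $m$ buckets $1,\dots,m$ (cyclically arranged) of capacity $b$ and $n$ keys is an assignment of hash addresses to $n$ labelled keys (there are $m^n$ of them); keys are placed by linear probing (each key in the first non-full bucket starting from its hash address, cyclically). A block is a maximal run of consecutive full buckets followed by a non-full bucket. $B_{m,n,k}$ is the number of hash tables with $m$ buckets and $n$ keys such that the rightmost bucket $m$ is not full and the block ending at bucket $m$ has length (number of buckets) $k$. In the formula, $q^{1/b}$ is any fixed $b$-th root (the product does not depend on the choice). *)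

theory Defs
  imports Complex_Main "HOL-Library.FuncSet" "HOL-Computational_Algebra.Formal_Power_Series"
begin

unbundle fps_syntax

text \<open>
  The buckets are \<open>1, \<dots>, m\<close>, arranged cyclically; the keys are \<open>0, \<dots>, n - 1\<close>, inserted in
  this order.
\<close>

definition hash_tables :: "nat \<Rightarrow> nat \<Rightarrow> (nat \<Rightarrow> nat) set" where
  "hash_tables m n = ({..<n} \<rightarrow>\<^sub>E {1..m})"

text \<open>The bucket reached from bucket \<open>i \<in> {1..m}\<close> after \<open>t\<close> cyclic steps to the right.\<close>

definition bucket_step :: "nat \<Rightarrow> nat \<Rightarrow> nat \<Rightarrow> nat" where
  "bucket_step m i t = (i + t - 1) mod m + 1"

text \<open>
  A state records the number of keys stored in each bucket. If all buckets are full the state is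
  left unchanged, so in a table with \<open>n \<ge> b * m\<close> keys every bucket ends up full.
\<close>

definition place_key :: "nat \<Rightarrow> nat \<Rightarrow> (nat \<Rightarrow> nat) \<Rightarrow> nat \<Rightarrow> nat \<Rightarrow> nat" where
  "place_key b m s i =
     (if \<exists>j\<in>{1..m}. s j < b
      then (let j = bucket_step m i (LEAST t. s (bucket_step m i t) < b) in s(j := s j + 1))
      else s)"

primrec occupancy :: "nat \<Rightarrow> nat \<Rightarrow> (nat \<Rightarrow> nat) \<Rightarrow> nat \<Rightarrow> nat \<Rightarrow> nat" where
  "occupancy b m h 0 = (\<lambda>_. 0)"
| "occupancy b m h (Suc n) = place_key b m (occupancy b m h n) (h n)"

definition full_bucket :: "nat \<Rightarrow> (nat \<Rightarrow> nat) \<Rightarrow> nat \<Rightarrow> bool" where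
  "full_bucket b s i \<longleftrightarrow> s i = b"

text \<open>
  The buckets \<open>i, i + 1, \<dots>, i + k - 1\<close> (cyclically) form a block: all but the last one are full,
  the last one is not, and by maximality neither is the cyclic predecessor of \<open>i\<close>. The length
  \<open>k\<close> includes the final non-full bucket; a non-full bucket preceded by a non-full bucket is a
  block of length 1.
\<close>

definition is_block :: "nat \<Rightarrow> nat \<Rightarrow> (nat \<Rightarrow> nat) \<Rightarrow> nat \<Rightarrow> nat \<Rightarrow> bool" where
  "is_block b m s i k \<longleftrightarrow>
     i \<in> {1..m} \<and> k \<in> {1..m} \<and>
     (\<forall>t<k - 1. full_bucket b s (bucket_step m i t)) \<and>
     \<not> full_bucket b s (bucket_step m i (k - 1)) \<and>
     \<not> full_bucket b s (bucket_step m i (m - 1))"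

definition block_count :: "nat \<Rightarrow> nat \<Rightarrow> nat \<Rightarrow> nat \<Rightarrow> nat" where
  "block_count b m n k =
     card {h \<in> hash_tables m n.
       \<not> full_bucket b (occupancy b m h n) m \<and>
       (\<exists>i. is_block b m (occupancy b m h n) i k \<and> bucket_step m i (k - 1) = m)}"

text \<open>
  Trivariate formal power series: series in \<open>z = fps_X\<close> over series in \<open>w\<close> over series in \<open>q\<close>
  (or in a \<open>b\<close>-th root of \<open>q\<close>), so that \<open>w\<close> is \<open>fps_const fps_X\<close> and a series \<open>f\<close> in the
  third variable alone is \<open>fps_const (fps_const f)\<close>.

  The variable \<open>z\<close> is outermost so that \<open>f / z\<close> is the library division by \<open>fps_X\<close>, i.e. an
  index shift; \<open>w\<close>-series over \<open>z\<close>-series would not do, as there \<open>z\<close> is a non-unit coefficient.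
\<close>

type_synonym fps3 = "complex fps fps fps"

abbreviation const3 :: "complex \<Rightarrow> fps3" where
  "const3 c \<equiv> fps_const (fps_const (fps_const c))"

text \<open>The substitution \<open>q := g\<close> in \<open>F(z, w, q)\<close>, where \<open>g\<close> has constant term 0.\<close>

definition subst_q :: "fps3 \<Rightarrow> complex fps \<Rightarrow> fps3" where
  "subst_q F g = Abs_fps (\<lambda>n. Abs_fps (\<lambda>l. (F $ n $ l) oo g))"

text \<open>\<open>B(z, w, q)\<close>: the coefficient of \<open>z^n w^l q^k\<close> is nonzero only for \<open>l = b * m\<close>.\<close>

definition block_gf :: "nat \<Rightarrow> fps3" where
  "block_gf b = Abs_fps (\<lambda>n. Abs_fps (\<lambda>l. Abs_fps (\<lambda>k.
     if b dvd l then of_nat (block_count b (l div b) n k) / fact n else 0)))"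

definition tree_series :: "complex fps" where
  "tree_series = Abs_fps (\<lambda>n. if n = 0 then 0 else of_nat (n ^ (n - 1)) / fact n)"

text \<open>\<open>T(x)\<close> for a trivariate series \<open>x\<close> divisible by \<open>z\<close>.\<close>

definition tree_at :: "fps3 \<Rightarrow> fps3" where
  "tree_at x = Abs_fps (\<lambda>n. fps_const (fps_const (tree_series $ n))) oo x"

text \<open>
  Coefficients of \<open>fps3\<close> do not form a field; division by a series whose constant term is nonzero
  is nevertheless the true quotient.
\<close>

lemma fps3_divide_mult:
  fixes f g :: fps3
  assumes "g $ 0 $ 0 $ 0 \<noteq> 0"
  shows "f / g * g = f"
proof -
  have 1: "inverse (g $ 0 $ 0) * (g $ 0 $ 0) = 1"
    using assms by (rule inverse_mult_eq_1)
  have 2: "inverse (g $ 0) * (g $ 0) = 1"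
    unfolding fps_inverse_def
    using 1 by (metis fps_inverse_def fps_left_inverse fps_left_inverse_eq_fps_right_inverse mult.commute)
  have 3: "inverse g * g = 1"
    using 2 by (metis fps_inverse_def fps_left_inverse fps_left_inverse_eq_fps_right_inverse mult.commute)
  have "g $ 0 \<noteq> 0" using assms by auto
  then show ?thesis
    using 3 by (simp add: fps_divide_unit mult.assoc)
qed

end

theory Submission
  imports Defs "HOL-Computational_Algebra.Polynomial"
begin

text \<open>
  If bucket \<open>m\<close> is not full, no key probes past it, so the table arises by non-cyclic probing and is
  a sequence of blocks; with \<open>A(z, w)\<close> the series of a single block this gives
  \<open>B(z, w, q) = A(z, w q\<^sup>1\<^sup>/\<^sup>b) / (1 - A(z, w))\<close>.

  It remains to see that \<open>1 - A(b z, w) = \<Prod>j. (1 - T(\<omega>\<^sup>j z w) / z)\<close>, for which the kernel method is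
  used. Let \<open>C\<^sub>r(y)\<close> be the series of \<open>r\<close> consecutive full buckets, \<open>y\<close> marking the overflow. Adding
  one bucket gives \<open>e\<^sup>b\<^sup>y C\<^sub>r(y) = y\<^sup>b C\<^sub>r\<^sub>+\<^sub>1(y) + a\<^sub>r(y)\<close>, where the polynomial \<open>a\<^sub>r\<close> of degree less
  than \<open>b\<close> counts blocks of length \<open>r + 1\<close>. At \<open>y = T(\<omega>\<^sup>j t)\<close> we have \<open>t\<^sup>b e\<^sup>b\<^sup>y = y\<^sup>b\<close>, so multiplying
  by \<open>t\<^sup>b\<^sup>(\<^sup>r\<^sup>+\<^sup>1\<^sup>)\<close> and summing over \<open>r\<close> telescopes to \<open>y\<^sup>b = \<Sum>r. t\<^sup>b\<^sup>(\<^sup>r\<^sup>+\<^sup>1\<^sup>) a\<^sub>r(y)\<close>. These are \<open>b\<close> distinct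
  roots of a monic polynomial of degree \<open>b\<close> in \<open>y\<close>, which therefore factors; put \<open>t = z w\<close> and \<open>y = z\<close>.
\<close>

section \<open>Linear probing as a non-cyclic process\<close>

text \<open>The numbers \<open>X p\<close> of keys with hash address \<open>p\<close>, listed from bucket \<open>m\<close> down to bucket 1.\<close>

primrec loads :: "(nat \<Rightarrow> nat) \<Rightarrow> nat \<Rightarrow> nat list" where
  "loads X 0 = []"
| "loads X (Suc i) = X (Suc i) # loads X i"

text \<open>
  Non-cyclic probing along the buckets whose loads are listed (the head is the last bucket): the
  number of keys that overflow the last bucket, and the length of the run of full buckets at the end.
\<close>

primrec probe_state :: "nat \<Rightarrow> nat list \<Rightarrow> nat \<times> nat" where
  "probe_state b [] = (0, 0)"
| "probe_state b (x # xs) = (case probe_state b xs of (q, r) \<Rightarrow>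
     if q + x < b then (0, 0) else (q + x - b, Suc r))"

abbreviation carry :: "nat \<Rightarrow> (nat \<Rightarrow> nat) \<Rightarrow> nat \<Rightarrow> nat" where
  "carry b X i \<equiv> fst (probe_state b (loads X i))"

abbreviation run :: "nat \<Rightarrow> (nat \<Rightarrow> nat) \<Rightarrow> nat \<Rightarrow> nat" where
  "run b X i \<equiv> snd (probe_state b (loads X i))"

definition load :: "nat \<Rightarrow> (nat \<Rightarrow> nat) \<Rightarrow> nat \<Rightarrow> nat" where
  "load n h p = card {j \<in> {..<n}. h j = p}"

text \<open>\<open>F p\<close> is the number of keys that probed bucket \<open>p\<close> in vain.\<close>

definition balanced :: "nat \<Rightarrow> nat \<Rightarrow> (nat \<Rightarrow> nat) \<Rightarrow> (nat \<Rightarrow> nat) \<Rightarrow> (nat \<Rightarrow> nat) \<Rightarrow> bool" where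
  "balanced b m X s F \<longleftrightarrow> (\<forall>p\<in>{1..m}. F (bucket_step m p (m - 1)) + X p = s p + F p \<and>
     s p \<le> b \<and> (F p > 0 \<longrightarrow> s p = b))"

text \<open>Truncated subtraction covers both branches of \<open>probe_state\<close>: a non-full
  bucket passes on 0 keys.\<close>

lemma carry_Suc: "carry b X (Suc i) = carry b X i + X (Suc i) - b"
  by (auto split: prod.splits)

lemma run_Suc:
  "run b X (Suc i) = (if carry b X i + X (Suc i) < b then 0 else Suc (run b X i))"
  by (auto split: prod.splits)

section \<open>Cyclic steps and the balance equations\<close>

lemma bucket_step_0: "p \<in> {1..m} \<Longrightarrow> bucket_step m p 0 = p"
  by (auto simp: bucket_step_def)

lemma bucket_step_in: "m \<ge> 1 \<Longrightarrow> bucket_step m p t \<in> {1..m}"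
  by (auto simp: bucket_step_def Suc_le_eq)

lemma bucket_step_add:
  assumes "p \<in> {1..m}"
  shows "bucket_step m (bucket_step m p t) u = bucket_step m p (t + u)"
proof -
  have "((p + t - 1) mod m + 1 + u - 1) mod m = (p + t - 1 + u) mod m"
    by (simp add: mod_add_left_eq)
  also have "p + t - 1 + u = p + (t + u) - 1"
    using assms by auto
  finally show ?thesis by (simp add: bucket_step_def)
qed

lemma bucket_step_period:
  assumes "p \<in> {1..m}"
  shows "bucket_step m p m = p"
proof -
  have "p + m - 1 = p - 1 + m" using assms by auto
  then have "(p + m - 1) mod m = p - 1" using assms by (simp only: mod_add_self2) auto
  then show ?thesis using assms by (simp add: bucket_step_def)
qed

lemma bucket_step_pred:
  assumes "p \<in> {1..m}"
  shows "bucket_step m p (m - 1) = (if p = 1 then m else p - 1)"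
proof (cases "p = 1")
  case False
  then have "p + (m - 1) - 1 = (p - 2) + m" using assms by auto
  then have "(p + (m - 1) - 1) mod m = p - 2" using assms by (simp only: mod_add_self2) auto
  then show ?thesis using assms False by (auto simp: bucket_step_def)
qed (use assms in \<open>auto simp: bucket_step_def\<close>)

lemma bucket_step_reach:
  assumes "p \<in> {1..m}" "j \<in> {1..m}"
  shows "\<exists>t. bucket_step m p t = j"
proof
  have "p + (m - p + j) - 1 = j - 1 + m" using assms by auto
  then have "(p + (m - p + j) - 1) mod m = j - 1" using assms by (simp only: mod_add_self2) auto
  then show "bucket_step m p (m - p + j) = j" using assms by (simp add: bucket_step_def)
qed

lemma bucket_step_pred_eq_iff:
  assumes "p \<in> {1..m}" "i \<in> {1..m}"
  shows "bucket_step m p (m - 1) = i \<longleftrightarrow> p = bucket_step m i 1"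
proof -
  have "m \<ge> 1" using assms by simp
  then show ?thesis
    using assms bucket_step_period bucket_step_add[of p m "m - 1" 1] bucket_step_add[of i m 1 "m - 1"]
    by (metis add.commute le_add_diff_inverse2)
qed

text \<open>Induction along the probe path: a key rejected by the full bucket \<open>i\<close>
  behaves like a key hashed to the next bucket, except for one more vain probe at
  \<open>i\<close>.\<close>

lemma balanced_add_key:
  assumes "balanced b m X s F" "i \<in> {1..m}"
    and "\<And>t'. t' < t \<Longrightarrow> s (bucket_step m i t') = b" "s (bucket_step m i t) < b"
  shows "\<exists>F. balanced b m (X(i := X i + 1))
    (s(bucket_step m i t := s (bucket_step m i t) + 1)) F"
  using assms
proof (induction t arbitrary: i)
  case 0
  then have "bucket_step m i 0 = i" by (simp add: bucket_step_0)
  then have "balanced b m (X(i := X i + 1)) (s(bucket_step m i 0 := s (bucket_step m i 0) + 1)) F"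
    using 0 by (auto simp: balanced_def)
  then show ?case by blast
next
  case (Suc t)
  let ?i = "bucket_step m i 1" and ?j = "bucket_step m i (Suc t)"
  have step: "bucket_step m ?i u = bucket_step m i (Suc u)" for u
    using bucket_step_add[OF Suc.prems(2), of 1 u] by simp
  have i': "?i \<in> {1..m}" using Suc.prems(2) by (intro bucket_step_in) auto
  obtain F where F: "balanced b m (X(?i := X ?i + 1)) (s(?j := s ?j + 1)) F"
    using Suc.IH[OF Suc.prems(1) i', unfolded step] Suc.prems(3,4) by (metis Suc_mono)
  have si: "s i = b" using Suc.prems(3)[of 0] Suc.prems(2) by (simp add: bucket_step_0)
  have ij: "?j \<noteq> i" using si Suc.prems(4) by auto
  \<comment> \<open>If \<open>i\<close> were its own successor, every cyclic step would stay at
    \<open>i\<close>, and the free bucket \<open>?j\<close> would be the full bucket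
    \<open>i\<close>.\<close>
  have ii: "?i \<noteq> i"
  proof
    assume eq: "?i = i"
    have "bucket_step m i u = i" for u
    proof (induction u)
      case 0
      then show ?case using Suc.prems(2) by (simp add: bucket_step_0)
    next
      case (Suc u)
      then show ?case using step[of u] eq by simp
    qed
    then show False using ij by blast
  qed
  \<comment> \<open>Moving the address of the key from \<open>?i\<close> back to \<open>i\<close> is
    compensated at \<open>?i\<close> by one more key flowing in from \<open>i\<close>.\<close>
  have "balanced b m (X(i := X i + 1)) (s(?j := s ?j + 1)) (F(i := F i + 1))"
    unfolding balanced_def
  proof
    fix p assume p: "p \<in> {1..m}"
    have pi: "bucket_step m p (m - 1) = i \<longleftrightarrow> p = ?i"
      using bucket_step_pred_eq_iff[OF p Suc.prems(2)] .
    show "(F(i := F i + 1)) (bucket_step m p (m - 1)) + (X(i := X i + 1)) p =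
       (s(?j := s ?j + 1)) p + (F(i := F i + 1)) p \<and> (s(?j := s ?j + 1)) p \<le> b \<and>
       (0 < (F(i := F i + 1)) p \<longrightarrow> (s(?j := s ?j + 1)) p = b)"
      using F[unfolded balanced_def, rule_format, OF p] pi ii ij si
      by (cases "p = ?i"; cases "p = i") auto
  qed
  then show ?case by blast
qed

lemma load_Suc:
  "load (Suc n) h p = load n h p + (if h n = p then 1 else 0)"
proof -
  have "{j \<in> {..<Suc n}. h j = p} = (if h n = p then insert n {j \<in> {..<n}. h j = p}
      else {j \<in> {..<n}. h j = p})"
    by (auto simp: less_Suc_eq)
  then show ?thesis by (simp add: load_def)
qed

lemma place_key_cases:
  assumes "i \<in> {1..m}" "\<exists>j\<in>{1..m}. s j < b"
  obtains t where "\<And>t'. t' < t \<Longrightarrow> s (bucket_step m i t') \<ge> b" "s (bucket_step m i t) < b"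
    "place_key b m s i = s(bucket_step m i t := s (bucket_step m i t) + 1)"
proof
  let ?t = "LEAST t. s (bucket_step m i t) < b"
  have ex: "\<exists>t. s (bucket_step m i t) < b"
    using assms bucket_step_reach by metis
  show "s (bucket_step m i ?t) < b"
    by (rule LeastI_ex[OF ex])
  show "s (bucket_step m i t') \<ge> b" if "t' < ?t" for t'
    using not_less_Least[OF that] by simp
  show "place_key b m s i = s(bucket_step m i ?t := s (bucket_step m i ?t) + 1)"
    using assms(2) by (simp add: place_key_def Let_def)
qed

lemma place_key_ge:
  assumes "i \<in> {1..m}"
  shows "place_key b m s i j \<ge> s j"
proof (cases "\<exists>j\<in>{1..m}. s j < b")
  case True
  then show ?thesis by (rule place_key_cases[OF assms]) auto
qed (simp add: place_key_def)

text \<open>Occupancies never decrease, so a bucket that is free at the end was free at every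
  insertion; hence no key was discarded.\<close>

lemma occupancy_balanced:
  assumes "\<And>j. j < n \<Longrightarrow> h j \<in> {1..m}" "\<exists>j\<in>{1..m}. occupancy b m h n j < b"
  shows "\<exists>F. balanced b m (load n h) (occupancy b m h n) F"
  using assms
proof (induction n)
  case 0
  have "balanced b m (load 0 h) (occupancy b m h 0) (\<lambda>_. 0)"
    by (simp add: balanced_def load_def)
  then show ?case by blast
next
  case (Suc n)
  let ?s = "occupancy b m h n"
  have hn: "h n \<in> {1..m}" using Suc.prems by simp
  have ex: "\<exists>j\<in>{1..m}. ?s j < b"
    using Suc.prems(2) le_less_trans[OF place_key_ge[OF hn]] by (metis occupancy.simps(2))
  then obtain F where F: "balanced b m (load n h) ?s F"
    using Suc.IH Suc.prems by auto
  obtain t where t: "\<And>t'. t' < t \<Longrightarrow> ?s (bucket_step m (h n) t') \<ge> b"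
      "?s (bucket_step m (h n) t) < b"
      "place_key b m ?s (h n) = ?s(bucket_step m (h n) t := ?s (bucket_step m (h n) t) + 1)"
    using place_key_cases[OF hn ex] by blast
  have "m \<ge> 1" using hn by simp
  then have "?s (bucket_step m (h n) t') = b" if "t' < t" for t'
    using t(1)[OF that] F bucket_step_in[of m "h n" t'] by (auto simp: balanced_def intro!: antisym)
  moreover have "load (Suc n) h = (load n h)(h n := load n h (h n) + 1)"
    by (auto simp: load_Suc)
  ultimately show ?case
    using balanced_add_key[OF F hn _ t(2)] t(3) by (simp del: fun_upd_apply)
qed

section \<open>Key counts and comparison with non-cyclic probing\<close>

lemma sum_occupancy_le: "(\<Sum>p\<in>{1..m}. occupancy b m h n p) \<le> n"
proof (induction n)
  case (Suc n)
  let ?s = "occupancy b m h n"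
  \<comment> \<open>Only an inequality, because a key arriving at a full table is discarded.\<close>
  have "(\<Sum>p\<in>{1..m}. place_key b m ?s i p) \<le> (\<Sum>p\<in>{1..m}. ?s p) + 1" for i
  proof (cases "\<exists>j\<in>{1..m}. ?s j < b")
    case True
    let ?j = "bucket_step m i (LEAST t. ?s (bucket_step m i t) < b)"
    have "place_key b m ?s i = (\<lambda>p. ?s p + (if p = ?j then 1 else 0))"
      using True by (auto simp: place_key_def Let_def)
    then show ?thesis by (simp add: sum.distrib)
  qed (simp add: place_key_def)
  from this[of "h n"] show ?case using Suc by simp
qed simp

lemma sum_load:
  assumes "\<And>j. j < n \<Longrightarrow> h j \<in> {1..m}"
  shows "(\<Sum>p\<in>{1..m}. load n h p) = n"
  using assms
proof (induction n)
  case (Suc n)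
  then have "h n \<in> {1..m}" by simp
  then have "(\<Sum>p\<in>{1..m}. if h n = p then 1 else 0 :: nat) = 1" by simp
  then show ?case using Suc by (simp add: load_Suc sum.distrib del: sum.delta sum.delta')
qed (simp add: load_def)

text \<open>Each bucket keeps at most \<open>b\<close> keys; the gap is the number of empty
  slots.\<close>

lemma sum_le_carry: "(\<Sum>p\<in>{1..i}. X p) \<le> b * i + carry b X i"
proof (induction i)
  case (Suc i)
  then show ?case by (simp add: carry_Suc del: loads.simps)
qed simp

text \<open>Non-cyclic probing starts with no inflow into bucket 1, cyclic probing with
  \<open>F m\<close>. Since each bucket keeps at most \<open>b\<close> keys, the inequality
  propagates to the right.\<close>

lemma balanced_carry_le:
  assumes "balanced b m X s F" "i \<in> {1..m}"
  shows "carry b X i \<le> F i"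
proof -
  \<comment> \<open>Index 0 is read as bucket \<open>m\<close>, the cyclic predecessor of bucket
    1.\<close>
  have "i \<le> m \<Longrightarrow> carry b X i \<le> (if i = 0 then F m else F i)" for i
  proof (induction i)
    case (Suc i)
    then have "bucket_step m (Suc i) (m - 1) = (if i = 0 then m else i)"
      by (subst bucket_step_pred) auto
    then have "(if i = 0 then F m else F i) + X (Suc i) = s (Suc i) + F (Suc i) \<and> s (Suc i) \<le> b"
      using assms(1)[unfolded balanced_def, rule_format, of "Suc i"] Suc.prems by (cases "i = 0") auto
    then show ?case using Suc by (auto simp: carry_Suc simp del: loads.simps)
  qed simp
  from this[of i] show ?thesis using assms(2) by simp
qed

text \<open>The balance conditions force how the arriving keys split: at most \<open>b\<close> stay,
  and none move on unless \<open>b\<close> stay.\<close>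

lemma balanced_step:
  assumes "balanced b m X s F" "Suc i \<in> {1..m}"
    and "(if i = 0 then F m else F i) = carry b X i"
  shows "F (Suc i) = carry b X (Suc i)" "s (Suc i) = min b (carry b X i + X (Suc i))"
proof -
  have "bucket_step m (Suc i) (m - 1) = (if i = 0 then m else i)"
    using assms(2) by (subst bucket_step_pred) auto
  then have "F (bucket_step m (Suc i) (m - 1)) = carry b X i"
    using assms(3) by (cases "i = 0") auto
  then have "carry b X i + X (Suc i) = s (Suc i) + F (Suc i) \<and> s (Suc i) \<le> b \<and>
      (F (Suc i) > 0 \<longrightarrow> s (Suc i) = b)"
    using assms(1)[unfolded balanced_def, rule_format, OF assms(2)] by simp
  then show "F (Suc i) = carry b X (Suc i)" "s (Suc i) = min b (carry b X i + X (Suc i))"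
    by (auto simp: carry_Suc simp del: loads.simps)
qed

lemma balanced_carry_eq:
  assumes "balanced b m X s F" "j \<le> m" "(if j = 0 then F m else F j) = carry b X j" "j \<le> i" "i \<le> m"
  shows "(if i = 0 then F m else F i) = carry b X i"
  using assms(4,5)
proof (induction i rule: dec_induct)
  case (step i)
  then show ?case using balanced_step(1)[OF assms(1), of i] by simp
qed (use assms(3) in simp)

text \<open>If the last bucket is free, nothing wraps around and both processes coincide from bucket
  1 on. Conversely, counting keys yields some free bucket, and they coincide from there on.\<close>

lemma last_bucket_full_iff:
  assumes h: "\<And>j. j < n \<Longrightarrow> h j \<in> {1..Suc m}"
  shows "occupancy b (Suc m) h n (Suc m) < b \<longleftrightarrow>
    carry b (load n h) m + load n h (Suc m) < b"
proof
  let ?s = "occupancy b (Suc m) h n" and ?c = "carry b (load n h)"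
  assume lt: "?s (Suc m) < b"
  then have "\<exists>j\<in>{1..Suc m}. ?s j < b" by (intro bexI[of _ "Suc m"]) auto
  then obtain F where F: "balanced b (Suc m) (load n h) ?s F"
    using occupancy_balanced[of n h "Suc m" b] h by blast
  have "F (Suc m) = 0" using F lt by (auto simp: balanced_def)
  then have "(if m = 0 then F (Suc m) else F m) = ?c m"
    using balanced_carry_eq[OF F, of 0 m] by simp
  from balanced_step(2)[OF F _ this] show "?c m + load n h (Suc m) < b"
    using lt by simp
next
  let ?s = "occupancy b (Suc m) h n" and ?c = "carry b (load n h)"
  assume lt: "?c m + load n h (Suc m) < b"
  have "n < b * Suc m"
    using sum_load[of n h "Suc m"] h sum_le_carry[of "load n h" m b] lt by simp
  have "\<not> (\<forall>p\<in>{1..Suc m}. b \<le> ?s p)"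
  proof
    assume "\<forall>p\<in>{1..Suc m}. b \<le> ?s p"
    then have "(\<Sum>p\<in>{1..Suc m}. b) \<le> (\<Sum>p\<in>{1..Suc m}. ?s p)" by (intro sum_mono) auto
    also have "\<dots> \<le> n" by (rule sum_occupancy_le)
    finally show False using \<open>n < b * Suc m\<close> by (simp add: mult.commute)
  qed
  then obtain j where j: "j \<in> {1..Suc m}" "?s j < b" by force
  then obtain F where F: "balanced b (Suc m) (load n h) ?s F"
    using occupancy_balanced[of n h "Suc m" b] h by blast
  have "F j = 0" using F j by (auto simp: balanced_def)
  \<comment> \<open>At a free bucket \<open>carry\<close> is squeezed between 0 and
    \<open>F j = 0\<close>.\<close>
  then have Fj: "F j = ?c j" using balanced_carry_le[OF F j(1)] by simp
  show "?s (Suc m) < b"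
  proof (cases "j = Suc m")
    case False
    then have "(if m = 0 then F (Suc m) else F m) = ?c m"
      using balanced_carry_eq[OF F, of j m] j(1) Fj by simp
    from balanced_step(2)[OF F _ this] show ?thesis using lt by simp
  qed (use j in simp)
qed

lemma occupancy_linear:
  assumes h: "\<And>j. j < n \<Longrightarrow> h j \<in> {1..Suc m}"
    and lt: "occupancy b (Suc m) h n (Suc m) < b" and "i \<le> m"
  shows "occupancy b (Suc m) h n (Suc i) = min b (carry b (load n h) i + load n h (Suc i))"
proof -
  have "\<exists>j\<in>{1..Suc m}. occupancy b (Suc m) h n j < b"
    using lt by (intro bexI[of _ "Suc m"]) auto
  then obtain F where F: "balanced b (Suc m) (load n h) (occupancy b (Suc m) h n) F"
    using occupancy_balanced[of n h "Suc m" b] h by blast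
  have "F (Suc m) = 0" using F lt by (auto simp: balanced_def)
  then have "(if i = 0 then F (Suc m) else F i) = carry b (load n h) i"
    using balanced_carry_eq[OF F, of 0 i] assms(3) by simp
  from balanced_step(2)[OF F _ this] show ?thesis using assms(3) by simp
qed

text \<open>Unlike the bound obtained from \<open>balanced\<close>, this one also covers full
  tables, where keys may have been discarded.\<close>

lemma occupancy_le:
  assumes h: "\<And>j. j < n \<Longrightarrow> h j \<in> {1..m}"
  shows "occupancy b m h n p \<le> b"
  using assms
proof (induction n arbitrary: p)
  case (Suc n)
  show ?case
  proof (cases "\<exists>j\<in>{1..m}. occupancy b m h n j < b")
    case True
    have "h n \<in> {1..m}" using Suc.prems by simp
    then obtain t where "occupancy b m h n (bucket_step m (h n) t) < b"
      "occupancy b m h (Suc n) = (occupancy b m h n)(bucket_step m (h n) t :=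
         occupancy b m h n (bucket_step m (h n) t) + 1)"
      using place_key_cases[OF _ True] by (metis occupancy.simps(2))
    then show ?thesis using Suc by auto
  qed (use Suc in \<open>auto simp: place_key_def\<close>)
qed simp

section \<open>Runs of full buckets and blocks\<close>

lemma run_eq_iff:
  "run b X i = r \<longleftrightarrow> r \<le> i \<and> (\<forall>l\<in>{i - r..<i}. b \<le> carry b X l + X (Suc l)) \<and>
     (r < i \<longrightarrow> carry b X (i - Suc r) + X (i - r) < b)"
proof (induction i arbitrary: r)
  case (Suc i)
  show ?case
  proof (cases r)
    case 0
    then show ?thesis by (simp add: run_Suc del: loads.simps)
  next
    case (Suc r')
    have "{Suc i - r..<Suc i} = (if r' \<le> i then insert i {i - r'..<i} else {Suc i - r..<Suc i})"
      using Suc by auto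
    then show ?thesis using Suc.IH[of r'] Suc by (auto simp: run_Suc simp del: loads.simps)
  qed
qed auto

text \<open>The free bucket \<open>Suc m\<close> closes the block, so length \<open>Suc k\<close>
  leaves a run of \<open>k\<close> full buckets before it. As nothing wraps around, the carries
  decide which buckets are full.\<close>

lemma block_event_iff:
  fixes b m n k :: nat and h :: "nat \<Rightarrow> nat"
  assumes h: "\<And>j. j < n \<Longrightarrow> h j \<in> {1..Suc m}"
  defines "s \<equiv> occupancy b (Suc m) h n" and "X \<equiv> load n h"
  shows "\<not> full_bucket b s (Suc m) \<and>
      (\<exists>i. is_block b (Suc m) s i (Suc k) \<and> bucket_step (Suc m) i k = Suc m) \<longleftrightarrow>
    carry b X m + X (Suc m) < b \<and> run b X m = k"
proof (cases "s (Suc m) < b")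
  case False
  then have "full_bucket b s (Suc m)"
    using occupancy_le[OF h, where b = b] by (auto simp: full_bucket_def s_def intro: antisym)
  then show ?thesis
    using False last_bucket_full_iff[OF h, where b = b] by (simp add: s_def X_def)
next
  case True
  have full: "full_bucket b s (Suc l) \<longleftrightarrow> b \<le> carry b X l + X (Suc l)" if "l \<le> m" for l
    using occupancy_linear[OF h True[unfolded s_def] that] by (auto simp: full_bucket_def s_def X_def)
  have c: "carry b X m + X (Suc m) < b"
    using True last_bucket_full_iff[OF h, where b = b] by (simp add: s_def X_def)
  have nf: "\<not> full_bucket b s (Suc m)" using True by (simp add: full_bucket_def)
  have "(\<exists>i. is_block b (Suc m) s i (Suc k) \<and> bucket_step (Suc m) i k = Suc m) \<longleftrightarrow> run b X m = k"
  proof (cases "k \<le> m")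
    case False
    then show ?thesis
      using run_eq_iff[of b X m k] by (auto simp: is_block_def)
  next
    case k: True
    \<comment> \<open>Since \<open>k \<le> m\<close>, a block ending at the last bucket cannot wrap
      around, which fixes its start.\<close>
    have idx: "bucket_step (Suc m) i k = Suc m \<longleftrightarrow> i = Suc m - k" if "i \<in> {1..Suc m}" for i
    proof -
      have "(i + k - 1) mod Suc m = m \<longleftrightarrow> i + k - 1 = m"
      proof (cases "i + k - 1 < Suc m")
        case False
        then have "(i + k - 1) mod Suc m = (i + k - 1 - Suc m) mod Suc m"
          by (simp add: le_mod_geq)
        also have "\<dots> = i + k - 1 - Suc m"
          using that k by (intro mod_less) auto
        finally show ?thesis using False that k by auto
      qed auto
      then show ?thesis using that k by (auto simp: bucket_step_def)
    qed
    let ?i = "Suc m - k"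
    have i: "?i \<in> {1..Suc m}" using k by auto
    have "(\<exists>i. is_block b (Suc m) s i (Suc k) \<and> bucket_step (Suc m) i k = Suc m) \<longleftrightarrow>
        is_block b (Suc m) s ?i (Suc k)"
      using idx i unfolding is_block_def by blast
    also have "\<dots> \<longleftrightarrow> (\<forall>t<k. full_bucket b s (bucket_step (Suc m) ?i t)) \<and>
        \<not> full_bucket b s (bucket_step (Suc m) ?i m)"
      using i k idx[OF i] nf by (simp add: is_block_def)
    also have "(\<forall>t<k. full_bucket b s (bucket_step (Suc m) ?i t)) \<longleftrightarrow>
        (\<forall>l\<in>{m - k..<m}. full_bucket b s (Suc l))"
    proof -
      have st: "bucket_step (Suc m) ?i t = Suc (m - k + t)" if "t < k" for t
        using that k by (simp add: bucket_step_def Suc_diff_le)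
      have "full_bucket b s (Suc l)"
        if "\<forall>t<k. full_bucket b s (Suc (m - k + t))" "l \<in> {m - k..<m}" for l
        using that(1)[rule_format, of "l - (m - k)"] that(2) k by auto
      moreover have "full_bucket b s (Suc (m - k + t))"
        if "\<forall>l\<in>{m - k..<m}. full_bucket b s (Suc l)" "t < k" for t
      proof -
        have "m - k + t \<in> {m - k..<m}" unfolding atLeastLessThan_iff using that(2) k by linarith
        then show ?thesis using that(1) by blast
      qed
      ultimately show ?thesis using st by (metis (no_types, lifting))
    qed
    also have "\<dots> \<longleftrightarrow> (\<forall>l\<in>{m - k..<m}. b \<le> carry b X l + X (Suc l))"
      using full by auto
    also have "\<not> full_bucket b s (bucket_step (Suc m) ?i m) \<longleftrightarrow>
        (k < m \<longrightarrow> carry b X (m - Suc k) + X (m - k) < b)"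
    proof (cases "k < m")
      case True
      then have "bucket_step (Suc m) ?i m = Suc (m - Suc k)"
        using bucket_step_pred[OF i] by (auto simp: Suc_diff_Suc)
      moreover have "Suc (m - Suc k) = m - k" using True by simp
      ultimately show ?thesis using True full[of "m - Suc k"] by (simp only:) auto
    next
      case False
      \<comment> \<open>For \<open>k = m\<close> the cyclic predecessor of the start is the free
        last bucket itself, so maximality is automatic.\<close>
      then have "bucket_step (Suc m) ?i m = Suc m"
        using bucket_step_pred[OF i] k by auto
      then show ?thesis using False nf by simp
    qed
    finally show ?thesis using run_eq_iff[of b X m k] k by simp
  qed
  then show ?thesis using c nf by simp
qed

section \<open>Counting hash tables by their loads\<close>

lemma natpermute_0_right: "natpermute n 0 = (if n = 0 then {[]} else {})"
  by (auto simp: natpermute_def)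

lemma sum_natpermute_Suc:
  fixes f :: "nat list \<Rightarrow> 'a::comm_monoid_add"
  shows "(\<Sum>xs\<in>natpermute n (Suc m). f xs) =
    (\<Sum>x\<le>n. \<Sum>xs\<in>natpermute (n - x) m. f (x # xs))"
proof -
  have "(\<Sum>x\<le>n. \<Sum>xs\<in>natpermute (n - x) m. f (x # xs)) =
      (\<Sum>(x, xs)\<in>(SIGMA x:{..n}. natpermute (n - x) m). f (x # xs))"
    by (rule sum.Sigma) (auto simp: natpermute_finite)
  also have "\<dots> = (\<Sum>xs\<in>natpermute n (Suc m). f xs)"
    by (rule sum.reindex_bij_witness[of _ "\<lambda>xs. (hd xs, tl xs)" "\<lambda>(x, xs). x # xs"])
      (auto simp: natpermute_def length_Suc_conv)
  finally show ?thesis ..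
qed

lemma sum_Pow_card:
  fixes f :: "nat \<Rightarrow> 'a::semiring_1"
  assumes "finite K"
  shows "(\<Sum>S\<in>Pow K. f (card S)) = (\<Sum>x\<le>card K. of_nat (card K choose x) * f x)"
proof -
  have "(\<Sum>S\<in>Pow K. f (card S)) = (\<Sum>x\<le>card K. \<Sum>S\<in>{S \<in> Pow K. card S = x}. f (card S))"
    using assms by (intro sum.group[symmetric]) (auto intro: card_mono)
  also have "\<dots> = (\<Sum>x\<le>card K. of_nat (card K choose x) * f x)"
    using assms by (intro sum.cong refl) (simp add: n_subsets)
  finally show ?thesis .
qed

lemma loads_cong: "(\<And>p. p \<in> {1..m} \<Longrightarrow> X p = Y p) \<Longrightarrow> loads X m = loads Y m"
  by (induction m) auto

text \<open>\<open>S\<close> is the set of keys hashed to the last bucket; the other keys form a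
  table with one bucket less.\<close>

lemma sum_PiE_Suc:
  fixes f :: "(nat \<Rightarrow> nat) \<Rightarrow> 'a::comm_monoid_add"
  assumes "finite K"
  shows "(\<Sum>h\<in>(K \<rightarrow>\<^sub>E {1..Suc m}). f h) =
    (\<Sum>S\<in>Pow K. \<Sum>g\<in>((K - S) \<rightarrow>\<^sub>E {1..m}). f (\<lambda>j. if j \<in> S then Suc m else g j))"
proof -
  have "(\<Sum>S\<in>Pow K. \<Sum>g\<in>((K - S) \<rightarrow>\<^sub>E {1..m}). f (\<lambda>j. if j \<in> S then Suc m else g j)) =
      (\<Sum>(S, g)\<in>(SIGMA S:Pow K. (K - S) \<rightarrow>\<^sub>E {1..m}). f (\<lambda>j. if j \<in> S then Suc m else g j))"
    using assms by (intro sum.Sigma) (auto intro!: finite_PiE)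
  also have "\<dots> = (\<Sum>h\<in>(K \<rightarrow>\<^sub>E {1..Suc m}). f h)"
  proof (rule sum.reindex_bij_witness[of _
        "\<lambda>h. ({j \<in> K. h j = Suc m}, restrict h {j \<in> K. h j \<noteq> Suc m})"
        "\<lambda>(S, g) j. if j \<in> S then Suc m else g j"])
    fix a assume a: "a \<in> (SIGMA S:Pow K. (K - S) \<rightarrow>\<^sub>E {1..m})"
    obtain S g where [simp]: "a = (S, g)" by (cases a)
    have S: "S \<subseteq> K" and g: "g \<in> (K - S) \<rightarrow>\<^sub>E {1..m}" using a by auto
    let ?h = "\<lambda>j. if j \<in> S then Suc m else g j"
    have "g j \<noteq> Suc m" if "j \<in> K - S" for j
      using PiE_mem[OF g that] by auto
    then have "{j \<in> K. ?h j = Suc m} = S" "{j \<in> K. ?h j \<noteq> Suc m} = K - S"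
      using S by auto
    moreover have "restrict ?h (K - S) = g"
      using g by (auto simp: fun_eq_iff PiE_def extensional_def)
    ultimately show "({j \<in> K. (case a of (S, g) \<Rightarrow> \<lambda>j. if j \<in> S then Suc m else g j) j = Suc m},
        restrict (case a of (S, g) \<Rightarrow> \<lambda>j. if j \<in> S then Suc m else g j)
          {j \<in> K. (case a of (S, g) \<Rightarrow> \<lambda>j. if j \<in> S then Suc m else g j) j \<noteq> Suc m}) = a"
      by (simp only: \<open>a = _\<close> prod.case)
    show "(case a of (S, g) \<Rightarrow> \<lambda>j. if j \<in> S then Suc m else g j) \<in> K \<rightarrow>\<^sub>E {1..Suc m}"
      using S g by (auto simp: PiE_iff extensional_def le_Suc_eq)
  qed (auto simp: fun_eq_iff PiE_iff extensional_def le_Suc_eq)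
  finally show ?thesis ..
qed

text \<open>A load list is realized by multinomially many tables. The key set is arbitrary because
  the induction removes the keys of the last bucket.\<close>

lemma sum_hash_tables_by_loads:
  fixes \<Phi> :: "nat list \<Rightarrow> complex" and K :: "nat set"
  assumes "finite K"
  shows "(\<Sum>h\<in>(K \<rightarrow>\<^sub>E {1..m}). \<Phi> (loads (\<lambda>p. card {j \<in> K. h j = p}) m)) =
    fact (card K) * (\<Sum>xs\<in>natpermute (card K) m. \<Phi> xs / (\<Prod>x\<leftarrow>xs. fact x))"
  using assms
proof (induction m arbitrary: K \<Phi>)
  case 0
  then show ?case by (cases "K = {}") (auto simp: natpermute_0_right PiE_eq_empty_iff)
next
  case (Suc m)
  let ?n = "card K"
  have loads: "loads (\<lambda>p. card {j \<in> K. (if j \<in> S then Suc m else g j) = p}) (Suc m) =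
      card S # loads (\<lambda>p. card {j \<in> K - S. g j = p}) m"
    if S: "S \<in> Pow K" and g: "g \<in> (K - S) \<rightarrow>\<^sub>E {1..m}" for S g
  proof -
    have "g j \<noteq> Suc m" if "j \<in> K - S" for j
      using PiE_mem[OF g that] by auto
    then have "{j \<in> K. (if j \<in> S then Suc m else g j) = Suc m} = S"
      using S by auto
    moreover have "{j \<in> K. (if j \<in> S then Suc m else g j) = p} = {j \<in> K - S. g j = p}"
      if "p \<in> {1..m}" for p
      using that by auto
    ultimately have "card {j \<in> K. (if j \<in> S then Suc m else g j) = Suc m} = card S"
      "loads (\<lambda>p. card {j \<in> K. (if j \<in> S then Suc m else g j) = p}) m =
        loads (\<lambda>p. card {j \<in> K - S. g j = p}) m"
      by (auto intro!: loads_cong simp del: mem_Collect_eq Collect_conj_eq simp only:)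
    then show ?thesis by (simp only: loads.simps)
  qed
  have "(\<Sum>h\<in>(K \<rightarrow>\<^sub>E {1..Suc m}). \<Phi> (loads (\<lambda>p. card {j \<in> K. h j = p}) (Suc m))) =
      (\<Sum>S\<in>Pow K. \<Sum>g\<in>((K - S) \<rightarrow>\<^sub>E {1..m}). \<Phi> (card S # loads (\<lambda>p. card {j \<in> K - S. g j = p}) m))"
    unfolding sum_PiE_Suc[OF Suc.prems] by (intro sum.cong refl) (simp only: loads)
  also have "\<dots> = (\<Sum>S\<in>Pow K. fact (?n - card S) *
      (\<Sum>xs\<in>natpermute (?n - card S) m. \<Phi> (card S # xs) / (\<Prod>x\<leftarrow>xs. fact x)))"
  proof (intro sum.cong refl)
    fix S assume "S \<in> Pow K"
    then have "finite (K - S)" and card: "card (K - S) = ?n - card S"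
      using Suc.prems by (auto simp: card_Diff_subset finite_subset)
    then show "(\<Sum>g\<in>((K - S) \<rightarrow>\<^sub>E {1..m}). \<Phi> (card S # loads (\<lambda>p. card {j \<in> K - S. g j = p}) m)) =
        fact (?n - card S) * (\<Sum>xs\<in>natpermute (?n - card S) m. \<Phi> (card S # xs) / (\<Prod>x\<leftarrow>xs. fact x))"
      using Suc.IH[of "K - S" "\<lambda>xs. \<Phi> (card S # xs)"] by (simp only:)
  qed
  also have "\<dots> = (\<Sum>x\<le>?n. of_nat (?n choose x) * (fact (?n - x) *
      (\<Sum>xs\<in>natpermute (?n - x) m. \<Phi> (x # xs) / (\<Prod>x\<leftarrow>xs. fact x))))"
    by (rule sum_Pow_card[OF Suc.prems])
  also have "\<dots> = (\<Sum>x\<le>?n. fact ?n *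
      (\<Sum>xs\<in>natpermute (?n - x) m. \<Phi> (x # xs) / (\<Prod>x\<leftarrow>x # xs. fact x)))"
    by (intro sum.cong refl) (simp add: binomial_fact sum_distrib_left field_simps)
  also have "\<dots> = fact ?n * (\<Sum>xs\<in>natpermute ?n (Suc m). \<Phi> xs / (\<Prod>x\<leftarrow>xs. fact x))"
    by (simp add: sum_natpermute_Suc sum_distrib_left)
  finally show ?case .
qed

text \<open>The factor \<open>b ^ x\<close> implements the substitution \<open>z := b z\<close>.\<close>

definition key_weight :: "nat \<Rightarrow> nat \<Rightarrow> complex" where
  "key_weight b x = of_nat b ^ x / fact x"

definition weight :: "nat \<Rightarrow> nat list \<Rightarrow> complex" where
  "weight b xs = (\<Prod>x\<leftarrow>xs. key_weight b x)"

text \<open>\<open>x\<close> is the load of the last bucket and \<open>xs\<close> lists the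
  \<open>m\<close> buckets before it, so \<open>k\<close> belongs to a block of length
  \<open>Suc k\<close>.\<close>

definition block_weight :: "nat \<Rightarrow> nat \<Rightarrow> nat \<Rightarrow> nat \<Rightarrow> complex" where
  "block_weight b m k n = (\<Sum>x\<le>n. \<Sum>xs\<in>natpermute (n - x) m.
     if fst (probe_state b xs) + x < b \<and> snd (probe_state b xs) = k
     then key_weight b x * weight b xs else 0)"

lemma weight_Cons: "weight b (x # xs) = key_weight b x * weight b xs"
  by (simp add: weight_def)

lemma weight_eq: "xs \<in> natpermute n m \<Longrightarrow> weight b xs = of_nat b ^ n / (\<Prod>x\<leftarrow>xs. fact x)"
proof (induction m arbitrary: n xs)
  case (Suc m)
  then obtain x ys where "xs = x # ys" "ys \<in> natpermute (n - x) m" "x \<le> n"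
    by (auto simp: natpermute_def length_Suc_conv)
  then show ?case
    using Suc.IH[of ys "n - x"] by (simp add: weight_def key_weight_def flip: power_add)
qed (auto simp: natpermute_0_right weight_def split: if_splits)

lemma block_count_0: "block_count b 0 n k = 0" "block_count b m n 0 = 0"
  by (auto simp: block_count_def is_block_def)

text \<open>By \<open>block_event_iff\<close> the event depends on the loads alone, so the
  multinomial count applies; \<open>weight_eq\<close> distributes \<open>of_nat b ^ n\<close> over
  the buckets.\<close>

lemma block_count_Suc:
  "of_nat b ^ n * of_nat (block_count b (Suc m) n (Suc k)) / fact n = block_weight b m k n"
proof -
  define P where "P xs \<longleftrightarrow> fst (probe_state b (tl xs)) + hd xs < b \<and> snd (probe_state b (tl xs)) = k"
    for xs
  have "{h \<in> hash_tables (Suc m) n. \<not> full_bucket b (occupancy b (Suc m) h n) (Suc m) \<and>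
      (\<exists>i. is_block b (Suc m) (occupancy b (Suc m) h n) i (Suc k) \<and>
        bucket_step (Suc m) i (Suc k - 1) = Suc m)} =
      {h \<in> hash_tables (Suc m) n. P (loads (load n h) (Suc m))}"
  proof (rule Collect_cong, rule conj_cong[OF refl])
    fix h assume "h \<in> hash_tables (Suc m) n"
    then have "h j \<in> {1..Suc m}" if "j < n" for j
      using that PiE_mem[of h "{..<n}" "\<lambda>_. {1..Suc m}" j] by (simp add: hash_tables_def)
    from block_event_iff[of n h, OF this, where b = b and k = k]
    show "(\<not> full_bucket b (occupancy b (Suc m) h n) (Suc m) \<and>
      (\<exists>i. is_block b (Suc m) (occupancy b (Suc m) h n) i (Suc k) \<and>
        bucket_step (Suc m) i (Suc k - 1) = Suc m)) = P (loads (load n h) (Suc m))"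
      by (simp add: P_def)
  qed
  then have "complex_of_nat (block_count b (Suc m) n (Suc k)) =
      (\<Sum>h\<in>hash_tables (Suc m) n. if P (loads (load n h) (Suc m)) then 1 else 0)"
    unfolding block_count_def
    by (subst sum.inter_filter[symmetric]) (simp_all add: hash_tables_def finite_PiE)
  also have "\<dots> = fact n * (\<Sum>xs\<in>natpermute n (Suc m). (if P xs then 1 else 0) / (\<Prod>x\<leftarrow>xs. fact x))"
    unfolding hash_tables_def load_def
    using sum_hash_tables_by_loads[of "{..<n}" "\<lambda>xs. if P xs then 1 else 0" "Suc m"]
    by (simp only: finite_lessThan card_lessThan)
  finally have "complex_of_nat b ^ n * of_nat (block_count b (Suc m) n (Suc k)) / fact n =
      of_nat b ^ n * (\<Sum>xs\<in>natpermute n (Suc m). (if P xs then 1 else 0) / (\<Prod>x\<leftarrow>xs. fact x))"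
    by simp
  also have "\<dots> = (\<Sum>xs\<in>natpermute n (Suc m). of_nat b ^ n * ((if P xs then 1 else 0) / (\<Prod>x\<leftarrow>xs. fact x)))"
    by (rule sum_distrib_left)
  also have "\<dots> = (\<Sum>xs\<in>natpermute n (Suc m). if P xs then weight b xs else 0)"
    by (intro sum.cong refl) (simp add: weight_eq)
  also have "\<dots> = block_weight b m k n"
    unfolding sum_natpermute_Suc block_weight_def P_def list.sel weight_Cons ..
  finally show ?thesis .
qed

section \<open>Generating functions of full runs and blocks\<close>

definition state_weight :: "nat \<Rightarrow> nat \<Rightarrow> nat \<Rightarrow> nat \<Rightarrow> nat \<Rightarrow> complex" where
  "state_weight b m q r n =
     (\<Sum>xs\<in>natpermute n m. if probe_state b xs = (q, r) then weight b xs else 0)"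

text \<open>Tables whose last bucket is not full, including the empty table with no buckets.\<close>

definition open_gf :: "nat \<Rightarrow> nat \<Rightarrow> complex fps" where
  "open_gf b m = Abs_fps (state_weight b m 0 0)"

text \<open>
  The coefficient of \<open>y ^ i\<close> in \<open>full_gf b r\<close> is the weight of \<open>r\<close> full buckets that overflow by
  \<open>i\<close> keys, hence hold \<open>b r + i\<close> keys; in \<open>last_gf b k\<close> it is the weight of a block of length
  \<open>k + 1\<close> with \<open>i\<close> keys in its last bucket, hence \<open>b k + i\<close> keys. The number of keys being
  determined, no second variable is needed.
\<close>

primrec full_gf :: "nat \<Rightarrow> nat \<Rightarrow> complex fps" where
  "full_gf b 0 = 1"
| "full_gf b (Suc r) = fps_shift b (fps_exp (of_nat b) * full_gf b r)"

definition last_gf :: "nat \<Rightarrow> nat \<Rightarrow> complex fps" where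
  "last_gf b k = fps_cutoff b (fps_exp (of_nat b) * full_gf b k)"

lemma key_weight_eq: "key_weight b x = fps_exp (of_nat b) $ x"
  by (simp add: key_weight_def)

lemma probe_state_run_0: "probe_state b xs = (q, 0) \<Longrightarrow> q = 0"
  by (cases xs) (auto split: prod.splits if_splits)

lemma probe_state_run_le: "snd (probe_state b xs) \<le> length xs"
  by (induction xs) (auto split: prod.splits)

lemma state_weight_Suc_Suc:
  "state_weight b (Suc m) q (Suc r) n =
    (\<Sum>x\<le>n. if x \<le> q + b then key_weight b x * state_weight b m (q + b - x) r (n - x) else 0)"
  unfolding state_weight_def sum_natpermute_Suc sum_distrib_left
proof (intro sum.cong refl)
  fix x
  have "probe_state b (x # xs) = (q, Suc r) \<longleftrightarrow> x \<le> q + b \<and> probe_state b xs = (q + b - x, r)" for xs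
    by (auto split: prod.splits)
  then show "(\<Sum>xs\<in>natpermute (n - x) m. if probe_state b (x # xs) = (q, Suc r) then weight b (x # xs) else 0) =
      (if x \<le> q + b then \<Sum>xs\<in>natpermute (n - x) m. key_weight b x *
        (if probe_state b xs = (q + b - x, r) then weight b xs else 0) else 0)"
    by (auto simp: weight_Cons simp del: probe_state.simps intro!: sum.cong sum.neutral)
qed

text \<open>Cut the table before its final run of \<open>r\<close> full buckets. No key crosses the
  cut, so the run and its overflow account for exactly \<open>b * r + q\<close> keys and the two
  parts are independent.\<close>

lemma state_weight_eq:
  "r \<le> m \<Longrightarrow> state_weight b m q r n =
    (if b * r + q \<le> n then full_gf b r $ q * open_gf b (m - r) $ (n - (b * r + q)) else 0)"
proof (induction r arbitrary: m q n)
  case 0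
  show ?case
  proof (cases "q = 0")
    case True
    then show ?thesis by (simp add: open_gf_def)
  next
    case False
    then have "state_weight b m q 0 n = 0"
      unfolding state_weight_def by (intro sum.neutral) (auto dest: probe_state_run_0)
    then show ?thesis using False by simp
  qed
next
  case (Suc r)
  then obtain m' where m: "m = Suc m'" "r \<le> m'" by (cases m) auto
  let ?N = "open_gf b (m' - r) $ (n - (b * Suc r + q))"
  have "state_weight b m q (Suc r) n = (\<Sum>x\<le>n. if x \<le> q + b \<and> b * Suc r + q \<le> n
      then key_weight b x * full_gf b r $ (q + b - x) * ?N else 0)"
    unfolding m(1) state_weight_Suc_Suc
  proof (intro sum.cong refl)
    fix x assume "x \<in> {..n}"
    then have "b * r + (q + b - x) \<le> n - x \<longleftrightarrow> b * Suc r + q \<le> n"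
      "n - x - (b * r + (q + b - x)) = n - (b * Suc r + q)" if "x \<le> q + b"
      using that by auto
    then show "(if x \<le> q + b then key_weight b x * state_weight b m' (q + b - x) r (n - x) else 0) =
        (if x \<le> q + b \<and> b * Suc r + q \<le> n
         then key_weight b x * full_gf b r $ (q + b - x) * ?N else 0)"
      using Suc.IH[OF m(2), of "q + b - x" "n - x"] by simp
  qed
  also have "\<dots> = (if b * Suc r + q \<le> n then full_gf b (Suc r) $ q * ?N else 0)"
  proof (cases "b * Suc r + q \<le> n")
    case True
    \<comment> \<open>Here \<open>x \<le> n\<close> is automatic, so the sum is the full coefficient
      of index \<open>q + b\<close>, which the shift in \<open>full_gf\<close> moves to
      \<open>q\<close>.\<close>
    then have "{x \<in> {..n}. x \<le> q + b} = {0..q + b}" by auto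
    then have "(\<Sum>x\<le>n. if x \<le> q + b then key_weight b x * full_gf b r $ (q + b - x) * ?N else 0) =
        (\<Sum>x=0..q+b. key_weight b x * full_gf b r $ (q + b - x)) * ?N"
      by (subst sum.inter_filter[symmetric]) (simp_all add: sum_distrib_right)
    then show ?thesis using True by (simp add: fps_mult_nth key_weight_eq)
  qed simp
  finally show ?case using m by simp
qed

text \<open>Regrouping by the final content \<open>i\<close> of the last bucket, of which
  \<open>i - x\<close> keys are carried over from the run.\<close>

lemma block_weight_eq_sum:
  "block_weight b m k n = (\<Sum>i<b. \<Sum>x\<le>i.
     if x \<le> n then key_weight b x * state_weight b m (i - x) k (n - x) else 0)"
proof -
  have "(if fst (probe_state b xs) + x < b \<and> snd (probe_state b xs) = k then c else 0) =
      (\<Sum>i<b. if x \<le> i \<and> probe_state b xs = (i - x, k) then c else 0)" for xs x and c :: complex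
  proof -
    have "(\<Sum>i<b. if x \<le> i \<and> probe_state b xs = (i - x, k) then c else 0) =
        (\<Sum>i<b. if i = fst (probe_state b xs) + x then if snd (probe_state b xs) = k then c else 0 else 0)"
      by (intro sum.cong refl) (auto simp: prod_eq_iff)
    then show ?thesis by (simp add: sum.delta)
  qed
  then have "block_weight b m k n = (\<Sum>x\<le>n. \<Sum>xs\<in>natpermute (n - x) m. \<Sum>i<b.
      if x \<le> i \<and> probe_state b xs = (i - x, k) then key_weight b x * weight b xs else 0)"
    by (simp add: block_weight_def)
  also have "\<dots> = (\<Sum>x\<le>n. \<Sum>i<b. \<Sum>xs\<in>natpermute (n - x) m.
      if x \<le> i \<and> probe_state b xs = (i - x, k) then key_weight b x * weight b xs else 0)"
    by (intro sum.cong refl sum.swap)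
  also have "\<dots> = (\<Sum>x\<le>n. \<Sum>i<b. if x \<le> i then key_weight b x * state_weight b m (i - x) k (n - x) else 0)"
    by (intro sum.cong refl) (auto simp: state_weight_def sum_distrib_left intro!: sum.cong)
  also have "\<dots> = (\<Sum>i<b. \<Sum>x\<le>n. if x \<le> i then key_weight b x * state_weight b m (i - x) k (n - x) else 0)"
    by (rule sum.swap)
  also have "\<dots> = (\<Sum>i<b. \<Sum>x\<le>i. if x \<le> n then key_weight b x * state_weight b m (i - x) k (n - x) else 0)"
  proof (rule sum.cong[OF refl])
    fix i
    show "(\<Sum>x\<le>n. if x \<le> i then key_weight b x * state_weight b m (i - x) k (n - x) else 0) =
        (\<Sum>x\<le>i. if x \<le> n then key_weight b x * state_weight b m (i - x) k (n - x) else 0)"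
      by (subst (1 2) sum.inter_filter[symmetric]) (auto intro: sum.cong)
  qed
  finally show ?thesis .
qed

lemma last_gf_nth: "last_gf b k $ i =
    (if i < b then \<Sum>x\<le>i. key_weight b x * full_gf b k $ (i - x) else 0)"
  by (simp add: last_gf_def fps_cutoff_nth fps_mult_nth key_weight_eq atLeast0AtMost)

text \<open>The overflow variable is identified with the key variable: the last bucket holds
  \<open>i\<close> keys, and the full buckets contribute \<open>fps_X ^ (b * k)\<close>.\<close>

lemma block_weight_eq:
  assumes "k \<le> m"
  shows "block_weight b m k n = (fps_X ^ (b * k) * last_gf b k * open_gf b (m - k)) $ n"
proof -
  have "block_weight b m k n =
      (\<Sum>i<b. if b * k + i \<le> n then last_gf b k $ i * open_gf b (m - k) $ (n - (b * k + i)) else 0)"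
    unfolding block_weight_eq_sum
  proof (intro sum.cong refl)
    fix i assume i: "i \<in> {..<b}"
    have "(\<Sum>x\<le>i. if x \<le> n then key_weight b x * state_weight b m (i - x) k (n - x) else 0) =
      (\<Sum>x\<le>i. if b * k + i \<le> n then key_weight b x * full_gf b k $ (i - x) *
        open_gf b (m - k) $ (n - (b * k + i)) else 0)"
    proof (intro sum.cong refl)
      fix x assume x: "x \<in> {..i}"
      then have "b * k + (i - x) \<le> n - x \<longleftrightarrow> b * k + i \<le> n" "n - x - (b * k + (i - x)) = n - (b * k + i)"
        if "x \<le> n"
        using that by auto
      then show "(if x \<le> n then key_weight b x * state_weight b m (i - x) k (n - x) else 0) =
        (if b * k + i \<le> n then key_weight b x * full_gf b k $ (i - x) *
        open_gf b (m - k) $ (n - (b * k + i)) else 0)"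
        using x state_weight_eq[OF assms, of b "i - x" "n - x"] by auto
    qed
    also have "\<dots> = (if b * k + i \<le> n then last_gf b k $ i * open_gf b (m - k) $ (n - (b * k + i)) else 0)"
      using i by (simp add: last_gf_nth sum_distrib_right)
    finally show "(\<Sum>x\<le>i. if x \<le> n then key_weight b x * state_weight b m (i - x) k (n - x) else 0) =
      (if b * k + i \<le> n then last_gf b k $ i * open_gf b (m - k) $ (n - (b * k + i)) else 0)" .
  qed
  also have "\<dots> = (fps_X ^ (b * k) * (last_gf b k * open_gf b (m - k))) $ n"
  proof (cases "b * k \<le> n")
    case True
    have "(\<Sum>i<b. if b * k + i \<le> n then last_gf b k $ i * open_gf b (m - k) $ (n - (b * k + i)) else 0) =
        (\<Sum>i\<in>{i\<in>{..<b}. b * k + i \<le> n}. last_gf b k $ i * open_gf b (m - k) $ (n - (b * k + i)))"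
      by (rule sum.inter_filter[symmetric]) simp
    also have "\<dots> = (\<Sum>i=0..n - b * k. last_gf b k $ i * open_gf b (m - k) $ (n - (b * k + i)))"
      using True by (intro sum.mono_neutral_cong_left) (auto simp: last_gf_nth)
    also have "\<dots> = (last_gf b k * open_gf b (m - k)) $ (n - b * k)"
      by (simp only: fps_mult_nth diff_diff_left)
    finally show ?thesis using True by (simp add: fps_X_power_mult_nth)
  qed (auto simp: fps_X_power_mult_nth intro!: sum.neutral)
  finally show ?thesis by (simp add: mult.assoc)
qed

section \<open>Decomposition by the last block\<close>

lemma open_gf_0: "open_gf b 0 = 1"
  by (rule fps_ext) (simp add: open_gf_def state_weight_def natpermute_0_right weight_def)

text \<open>A renewal equation: removing the last block, of length \<open>Suc k\<close>, leaves an
  open table with \<open>m - k\<close> buckets.\<close>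

lemma open_gf_Suc:
  "open_gf b (Suc m) = (\<Sum>k\<le>m. fps_X ^ (b * k) * last_gf b k * open_gf b (m - k))"
proof (rule fps_ext)
  fix n
  have "probe_state b (x # xs) = (0, 0) \<longleftrightarrow> fst (probe_state b xs) + x < b" for x xs
    by (auto split: prod.splits)
  then have "open_gf b (Suc m) $ n = (\<Sum>x\<le>n. \<Sum>xs\<in>natpermute (n - x) m.
      if fst (probe_state b xs) + x < b then key_weight b x * weight b xs else 0)"
    by (simp add: open_gf_def state_weight_def sum_natpermute_Suc del: probe_state.simps)
      (simp only: weight_Cons)
  also have "\<dots> = (\<Sum>x\<le>n. \<Sum>xs\<in>natpermute (n - x) m. \<Sum>k\<le>m.
      if fst (probe_state b xs) + x < b \<and> snd (probe_state b xs) = k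
      then key_weight b x * weight b xs else 0)"
  proof (intro sum.cong refl)
    fix x xs assume "xs \<in> natpermute (n - x) m"
    then have "snd (probe_state b xs) \<le> m"
      using probe_state_run_le[of b xs] by (auto simp: natpermute_def)
    then show "(if fst (probe_state b xs) + x < b then key_weight b x * weight b xs else 0) =
        (\<Sum>k\<le>m. if fst (probe_state b xs) + x < b \<and> snd (probe_state b xs) = k
          then key_weight b x * weight b xs else 0)"
      by (cases "fst (probe_state b xs) + x < b") (simp_all add: sum.delta)
  qed
  also have "\<dots> = (\<Sum>x\<le>n. \<Sum>k\<le>m. \<Sum>xs\<in>natpermute (n - x) m.
      if fst (probe_state b xs) + x < b \<and> snd (probe_state b xs) = k
      then key_weight b x * weight b xs else 0)"
    by (intro sum.cong refl sum.swap)
  also have "\<dots> = (\<Sum>k\<le>m. block_weight b m k n)"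
    unfolding block_weight_def by (rule sum.swap)
  also have "\<dots> = (\<Sum>k\<le>m. fps_X ^ (b * k) * last_gf b k * open_gf b (m - k)) $ n"
    by (simp add: fps_sum_nth block_weight_eq)
  finally show "open_gf b (Suc m) $ n =
      (\<Sum>k\<le>m. fps_X ^ (b * k) * last_gf b k * open_gf b (m - k)) $ n" .
qed

section \<open>The tree function and the kernel equation\<close>

text \<open>Up to \<open>fact M\<close>, the sum is the coefficient of \<open>x ^ M\<close> in
  \<open>(exp x - 1) ^ N\<close>, a series of order \<open>N\<close>.\<close>

lemma finite_difference_power:
  assumes "M < N"
  shows "(\<Sum>n\<le>N. of_nat (N choose n) * (-1) ^ (N - n) * of_nat n ^ M) = (0 :: complex)"
proof -
  have "(fps_exp 1 - 1 :: complex fps) ^ N =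
      (\<Sum>n\<le>N. of_nat (N choose n) * fps_exp 1 ^ n * (- 1) ^ (N - n))"
    using binomial_ring[of "fps_exp 1 :: complex fps" "- 1" N] by simp
  also have "\<dots> = (\<Sum>n\<le>N. fps_const (of_nat (N choose n) * (-1) ^ (N - n)) * fps_exp (of_nat n))"
    by (intro sum.cong refl)
      (simp add: fps_exp_power_mult fps_of_nat mult_ac flip: fps_const_mult fps_const_power fps_const_neg)
  finally have "(fps_exp 1 - 1 :: complex fps) ^ N $ M =
      (\<Sum>n\<le>N. of_nat (N choose n) * (-1) ^ (N - n) * (of_nat n ^ M / fact M))"
    by (simp add: fps_sum_nth)
  moreover have "(fps_exp 1 - 1 :: complex fps) ^ N $ M = 0"
    using startsby_zero_power_prefix[of "fps_exp 1 - 1 :: complex fps" N] assms by simp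
  ultimately have "(\<Sum>n\<le>N. of_nat (N choose n) * (-1) ^ (N - n) * of_nat n ^ M) / fact M = (0 :: complex)"
    by (simp add: sum_divide_distrib)
  then show ?thesis by simp
qed

text \<open>
  Coefficientwise this says that the \<open>N\<close>-th finite difference of \<open>n \<mapsto> n\<^sup>N\<^sup>-\<^sup>1\<close> vanishes.
\<close>

lemma tree_series_compose: "tree_series oo (fps_X * fps_exp (- 1)) = fps_X"
proof (rule fps_ext)
  fix N
  have summand: "tree_series $ n * ((fps_X * fps_exp (- 1)) ^ n $ N) =
      of_nat (N choose n) * (-1) ^ (N - n) * of_nat n ^ (N - 1) / fact N"
    if "n \<le> N" "2 \<le> N" for n
  proof (cases "n = 0")
    case False
    have "(fps_X * fps_exp (- 1)) ^ n $ N = (- of_nat n) ^ (N - n) / (fact (N - n) :: complex)"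
      using that by (simp add: power_mult_distrib fps_exp_power_mult fps_X_power_mult_nth)
    also have "(- of_nat n :: complex) ^ (N - n) = (- 1) ^ (N - n) * of_nat n ^ (N - n)"
      by (rule power_minus)
    finally have "tree_series $ n * ((fps_X * fps_exp (- 1)) ^ n $ N) =
        (of_nat n ^ (n - 1) * of_nat n ^ (N - n)) * (- 1) ^ (N - n) / (fact n * fact (N - n))"
      using False by (simp add: tree_series_def)
    also have "of_nat n ^ (n - 1) * of_nat n ^ (N - n) = (of_nat n ^ (N - 1) :: complex)"
      using that False by (simp flip: power_add)
    finally show ?thesis
      using that by (simp add: binomial_fact)
  qed (use that in \<open>simp add: tree_series_def\<close>)
  \<comment> \<open>For \<open>N < 2\<close> the summand formula fails at \<open>n = 0\<close>,
    since \<open>0 ^ (N - 1)\<close> is 1 while \<open>tree_series $ 0 = 0\<close>.\<close>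
  consider "N = 0" | "N = 1" | "2 \<le> N" by linarith
  then show "(tree_series oo (fps_X * fps_exp (- 1))) $ N = fps_X $ N"
  proof cases
    case 3
    then have "(tree_series oo (fps_X * fps_exp (- 1))) $ N =
        (\<Sum>n\<le>N. of_nat (N choose n) * (-1) ^ (N - n) * of_nat n ^ (N - 1)) / fact N"
      unfolding fps_compose_nth atLeast0AtMost sum_divide_distrib
      by (intro sum.cong refl summand) auto
    then show ?thesis using finite_difference_power[of "N - 1" N] 3 by simp
  qed (simp_all add: fps_compose_nth tree_series_def)
qed

lemma tree_series_0: "tree_series $ 0 = 0"
  by (simp add: tree_series_def)

text \<open>A one-sided compositional inverse of \<open>x * exp (- x)\<close> is two-sided, so
  \<open>T * exp (- T) = x\<close>.\<close>

lemma tree_series_functional_eq: "tree_series = fps_X * (fps_exp 1 oo tree_series)"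
proof -
  let ?g = "fps_X * fps_exp (- 1) :: complex fps"
  have g: "?g $ 0 = 0" "?g $ 1 \<noteq> 0" by simp_all
  have "tree_series = tree_series oo (?g oo fps_inv ?g)"
    by (simp only: fps_inv_right[OF g] fps_compose_fps_X)
  also have "\<dots> = fps_inv ?g"
    using g by (subst fps_compose_assoc) (simp_all add: tree_series_compose fps_inv_def)
  finally have "?g oo tree_series = fps_X"
    using fps_inv_right[OF g] by simp
  then have "tree_series * (fps_exp (- 1) oo tree_series) = fps_X"
    by (simp add: fps_compose_mult_distrib tree_series_0)
  then have "fps_X * (fps_exp 1 oo tree_series) =
      tree_series * ((fps_exp (- 1) oo tree_series) * (fps_exp 1 oo tree_series))"
    by (metis mult.assoc)
  also have "(fps_exp (- 1) oo tree_series) * (fps_exp 1 oo tree_series) = 1"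
    by (simp add: tree_series_0 flip: fps_compose_mult_distrib fps_exp_add_mult)
  finally show ?thesis by simp
qed

text \<open>For \<open>c ^ b = 1\<close> these are solutions of
  \<open>y ^ b = t ^ b * exp (b * y)\<close> that vanish at 0.\<close>

definition branch :: "complex \<Rightarrow> complex fps" where
  "branch c = tree_series oo (fps_const c * fps_X)"

lemma branch_nth: "branch c $ n = c ^ n * tree_series $ n"
  by (simp add: branch_def fps_compose_linear)

lemma branch_kernel:
  assumes "c ^ b = 1"
  shows "branch c ^ b = fps_X ^ b * (fps_exp (of_nat b) oo branch c)"
proof -
  have c: "(fps_const c * fps_X) $ 0 = 0" by simp
  have "tree_series ^ b = fps_X ^ b * (fps_exp 1 oo tree_series) ^ b"
    by (metis tree_series_functional_eq power_mult_distrib)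
  also have "(fps_exp 1 oo tree_series) ^ b = fps_exp (of_nat b) oo tree_series"
    by (simp add: fps_compose_power tree_series_0 fps_exp_power_mult)
  finally have "tree_series ^ b oo (fps_const c * fps_X) =
      (fps_const c * fps_X) ^ b * (fps_exp (of_nat b) oo branch c)"
    by (simp only: fps_compose_mult_distrib[OF c] branch_def fps_compose_assoc[OF c tree_series_0]
        fps_X_fps_compose_startby0[OF c] flip: fps_compose_power[OF c])
  then show ?thesis
    using assms by (simp add: branch_def fps_compose_power power_mult_distrib fps_const_power)
qed

text \<open>The coefficient \<open>p\<^sub>i(t)\<close> of the kernel polynomial \<open>y ^ b - \<Sum> p\<^sub>i(t) y ^ i\<close>.\<close>

definition kernel_coeff :: "nat \<Rightarrow> nat \<Rightarrow> complex fps" where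
  "kernel_coeff b i = Abs_fps (\<lambda>N. if b dvd N \<and> N > 0 then last_gf b (N div b - 1) $ i else 0)"

section \<open>The kernel equation and its solutions\<close>

lemma full_last_gf:
  "fps_exp (of_nat b) * full_gf b k = fps_X ^ b * full_gf b (Suc k) + last_gf b k"
  by (simp add: last_gf_def fps_shift_cutoff')

lemma last_gf_compose:
  assumes "Y $ 0 = 0"
  shows "last_gf b k oo Y = (\<Sum>i<b. fps_const (last_gf b k $ i) * Y ^ i)"
proof (rule fps_ext)
  fix n
  \<comment> \<open>A common range for both sums: terms with \<open>i > n\<close> vanish by the
    order of \<open>Y ^ i\<close>, those with \<open>i \<ge> b\<close> by the cutoff.\<close>
  have "(last_gf b k oo Y) $ n = (\<Sum>i\<le>max n b. last_gf b k $ i * Y ^ i $ n)"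
    unfolding fps_compose_nth using startsby_zero_power_prefix[OF assms]
    by (intro sum.mono_neutral_left) auto
  also have "\<dots> = (\<Sum>i<b. last_gf b k $ i * Y ^ i $ n)"
    by (intro sum.mono_neutral_right) (auto simp: last_gf_nth)
  finally show "(last_gf b k oo Y) $ n = (\<Sum>i<b. fps_const (last_gf b k $ i) * Y ^ i) $ n"
    by (simp add: fps_sum_nth)
qed

lemma kernel_telescope:
  assumes "Y $ 0 = 0" "Y ^ b = fps_X ^ b * (fps_exp (of_nat b) oo Y)"
  shows "Y ^ b = Y ^ b * fps_X ^ (b * K) * (full_gf b K oo Y) +
    (\<Sum>k<K. fps_X ^ (b * Suc k) * (last_gf b k oo Y))"
proof (induction K)
  case (Suc K)
  have "(fps_exp (of_nat b) oo Y) * (full_gf b K oo Y) = Y ^ b * (full_gf b (Suc K) oo Y) + (last_gf b K oo Y)"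
    using arg_cong[OF full_last_gf[of b K], of "\<lambda>f. f oo Y"] assms(1)
    by (simp add: fps_compose_mult_distrib fps_compose_add_distrib del: full_gf.simps flip: fps_compose_power)
  then have "fps_X ^ (b * Suc K) * ((fps_exp (of_nat b) oo Y) * (full_gf b K oo Y)) =
      fps_X ^ (b * Suc K) * (Y ^ b * (full_gf b (Suc K) oo Y) + (last_gf b K oo Y))"
    by simp
  moreover have "fps_X ^ (b * Suc K) * ((fps_exp (of_nat b) oo Y) * (full_gf b K oo Y)) =
      Y ^ b * fps_X ^ (b * K) * (full_gf b K oo Y)"
    unfolding assms(2) by (simp add: power_add mult_ac)
  ultimately have "Y ^ b * fps_X ^ (b * K) * (full_gf b K oo Y) =
      Y ^ b * fps_X ^ (b * Suc K) * (full_gf b (Suc K) oo Y) + fps_X ^ (b * Suc K) * (last_gf b K oo Y)"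
    (is "?A = ?B + ?l") by (simp only: distrib_left mult_ac)
  with Suc have "Y ^ b = (?B + ?l) + (\<Sum>k<K. fps_X ^ (b * Suc k) * (last_gf b k oo Y))"
    by (rule trans[OF _ arg_cong[of ?A _ "\<lambda>x. x + _"]])
  also have "\<dots> = ?B + (\<Sum>k<Suc K. fps_X ^ (b * Suc k) * (last_gf b k oo Y))"
    by (simp only: sum.lessThan_Suc ac_simps)
  finally show ?case .
qed simp

text \<open>The telescoped identity holds modulo \<open>t\<^sup>b\<^sup>K\<close> for every \<open>K\<close>.\<close>

lemma kernel_root:
  assumes "b \<ge> 1" "Y $ 0 = 0" "Y ^ b = fps_X ^ b * (fps_exp (of_nat b) oo Y)"
  shows "Y ^ b = (\<Sum>i<b. kernel_coeff b i * Y ^ i)"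
proof (rule fps_ext)
  fix N
  have N: "N < b * Suc N" using assms(1) by (induction b rule: nat_induct_at_least) auto
  have X: "(fps_X ^ j * fps_const c) $ M = (if M = j then c else 0)" for j M and c :: complex
    by (auto simp: fps_X_power_mult_nth)
  \<comment> \<open>\<open>A i\<close> truncates \<open>kernel_coeff b i\<close>; every omitted term
    has degree above \<open>N\<close>.\<close>
  define A where "A i = (\<Sum>k<Suc N. fps_X ^ (b * Suc k) * fps_const (last_gf b k $ i))" for i
  have trunc: "A i $ M = kernel_coeff b i $ M"
    if "M \<le> N" for M i
  proof (cases "\<exists>k. M = b * Suc k")
    case True
    then obtain k where M: "M = b * Suc k" ..
    have "Suc k \<le> M" using M mult_le_mono1[OF assms(1), of "Suc k"] by simp
    then have k: "k < Suc N" using that by simp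
    have "A i $ M = (\<Sum>k'<Suc N. if k' = k then last_gf b k $ i else 0)"
      unfolding A_def fps_sum_nth X using assms(1) M
      by (intro sum.cong refl) (simp del: mult_Suc_right)
    also have "\<dots> = last_gf b k $ i" using k by (simp add: sum.delta del: sum.lessThan_Suc)
    also have "\<dots> = kernel_coeff b i $ M"
      using assms(1) M by (simp add: kernel_coeff_def del: mult_Suc_right)
    finally show ?thesis .
  next
    case False
    then have "\<not> (b dvd M \<and> M > 0)" by (metis dvdE gr0_implies_Suc nat_0_less_mult_iff)
    then have "kernel_coeff b i $ M = 0" by (simp only: kernel_coeff_def fps_nth_Abs_fps if_False)
    moreover have "A i $ M = 0"
      unfolding A_def fps_sum_nth X using False by (intro sum.neutral) simp
    ultimately show ?thesis by simp
  qed
  have "Y ^ b $ N = (Y ^ b * fps_X ^ (b * Suc N) * (full_gf b (Suc N) oo Y)) $ N +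
    (\<Sum>k<Suc N. fps_X ^ (b * Suc k) * (last_gf b k oo Y)) $ N"
    by (subst kernel_telescope[OF assms(2,3), of "Suc N"]) (rule fps_add_nth)
  also have "Y ^ b * fps_X ^ (b * Suc N) * (full_gf b (Suc N) oo Y) =
      fps_X ^ (b * Suc N) * (Y ^ b * (full_gf b (Suc N) oo Y))"
    by (simp only: mult_ac)
  also have "\<dots> $ N = 0" using N by (simp only: fps_X_power_mult_nth if_True)
  also have "(\<Sum>k<Suc N. fps_X ^ (b * Suc k) * (last_gf b k oo Y)) =
      (\<Sum>k<Suc N. \<Sum>i<b. fps_X ^ (b * Suc k) * fps_const (last_gf b k $ i) * Y ^ i)"
    by (simp only: last_gf_compose[OF assms(2)] sum_distrib_left mult.assoc)
  also have "\<dots> = (\<Sum>i<b. A i * Y ^ i)"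
    unfolding A_def sum_distrib_right by (rule sum.swap)
  also have "\<dots> $ N = (\<Sum>i<b. kernel_coeff b i * Y ^ i) $ N"
    unfolding fps_sum_nth fps_mult_nth
    by (intro sum.cong refl) (simp only: trunc diff_le_self atLeastAtMost_iff)
  finally show "Y ^ b $ N = (\<Sum>i<b. kernel_coeff b i * Y ^ i) $ N" by simp
qed

section \<open>Factorization of the block series\<close>

lemma fps_const_sum: "fps_const (sum f A) = (\<Sum>i\<in>A. fps_const (f i))"
  by (induction A rule: infinite_finite_induct) (simp_all flip: fps_const_add)

lemma positive_multiple_cases:
  fixes b l :: nat
  obtains k where "l = b * Suc k" | "\<not> b dvd l \<or> l = 0"
  by (metis dvdE mult_0_right not0_implies_Suc)

text \<open>The series \<open>f(z w \<rho>)\<close>.\<close>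

definition zw_series :: "complex fps \<Rightarrow> complex fps \<Rightarrow> fps3" where
  "zw_series \<rho> f = Abs_fps (\<lambda>n. fps_const (fps_const (f $ n)) * (fps_X * fps_const \<rho>) ^ n)"

lemma zw_series_nth_nth:
  "zw_series \<rho> f $ n $ l = (if l = n then fps_const (f $ n) * \<rho> ^ n else 0)"
  by (auto simp: zw_series_def power_mult_distrib fps_X_power_mult_nth simp flip: mult.assoc)

text \<open>Being a substitution, \<open>zw_series \<rho>\<close> is a ring homomorphism; this
  carries the kernel equation over to three variables.\<close>

lemma zw_series_mult: "zw_series \<rho> (f * g) = zw_series \<rho> f * zw_series \<rho> g"
proof (rule fps_ext)
  fix n
  let ?c = "\<lambda>x. fps_const (fps_const x) :: complex fps fps" and ?v = "fps_X * fps_const \<rho>"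
  have "(zw_series \<rho> f * zw_series \<rho> g) $ n =
      (\<Sum>i=0..n. ?c (f $ i) * ?v ^ i * (?c (g $ (n - i)) * ?v ^ (n - i)))"
    by (simp add: fps_mult_nth zw_series_def)
  also have "\<dots> = (\<Sum>i=0..n. ?c (f $ i * g $ (n - i)) * ?v ^ n)"
  proof (intro sum.cong refl)
    fix i assume "i \<in> {0..n}"
    then have "?v ^ n = ?v ^ i * ?v ^ (n - i)" by (simp flip: power_add)
    then show "?c (f $ i) * ?v ^ i * (?c (g $ (n - i)) * ?v ^ (n - i)) = ?c (f $ i * g $ (n - i)) * ?v ^ n"
      by (simp only: mult_ac flip: fps_const_mult)
  qed
  also have "\<dots> = zw_series \<rho> (f * g) $ n"
    by (simp only: zw_series_def fps_nth_Abs_fps fps_mult_nth fps_const_sum sum_distrib_right)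
  finally show "zw_series \<rho> (f * g) $ n = (zw_series \<rho> f * zw_series \<rho> g) $ n" ..
qed

lemma zw_series_1: "zw_series \<rho> 1 = 1"
  by (rule fps_ext) (auto simp: zw_series_def)

lemma zw_series_power: "zw_series \<rho> (f ^ k) = zw_series \<rho> f ^ k"
  by (induction k) (simp_all add: zw_series_1 zw_series_mult)

lemma zw_series_add: "zw_series \<rho> (f + g) = zw_series \<rho> f + zw_series \<rho> g"
  by (rule fps_ext) (simp add: zw_series_def distrib_right flip: fps_const_add)

lemma zw_series_sum: "finite A \<Longrightarrow> zw_series \<rho> (\<Sum>i\<in>A. f i) = (\<Sum>i\<in>A. zw_series \<rho> (f i))"
  by (induction A rule: finite_induct) (simp_all add: zw_series_add, simp add: zw_series_def fps_eq_iff)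

text \<open>As a series in \<open>z\<close> the argument is a constant times \<open>z\<close>, so
  the composition only scales coefficients.\<close>

lemma tree_at_eq:
  "tree_at (const3 c * fps_X * fps_const fps_X * fps_const (fps_const \<rho>)) = zw_series \<rho> (branch c)"
proof -
  have "const3 c * fps_X * fps_const fps_X * fps_const (fps_const \<rho>) =
      fps_const (fps_const (fps_const c) * (fps_X * fps_const \<rho>)) * fps_X"
    by (simp add: mult_ac flip: fps_const_mult)
  then show ?thesis
    unfolding tree_at_def zw_series_def
    by (simp only: fps_compose_linear, intro fps_ext)
      (simp add: branch_nth power_mult_distrib mult_ac)
qed

text \<open>The coefficient of \<open>z w\<close> is \<open>c\<close> times \<open>\<rho>\<close>
  and already determines \<open>c\<close>.\<close>

lemma zw_series_branch_inj:
  assumes "\<rho> \<noteq> 0" "zw_series \<rho> (branch c) = zw_series \<rho> (branch d)"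
  shows "c = d"
proof -
  have "fps_const c * \<rho> = fps_const d * \<rho>"
    using arg_cong[OF assms(2), of "\<lambda>F. F $ 1 $ 1"]
    by (simp add: zw_series_nth_nth branch_nth tree_series_def)
  then have "fps_const c = fps_const d" using assms(1) by simp
  then show ?thesis by (metis fps_nth_fps_const)
qed

text \<open>Two monic polynomials of degree \<open>b\<close> that agree at \<open>b\<close> distinct
  points are equal; an integral domain suffices, as needed for \<open>fps3\<close>.\<close>

lemma monic_poly_eq_prod_roots:
  fixes a :: "nat \<Rightarrow> 'a::idom" and u :: "nat \<Rightarrow> 'a"
  assumes "inj_on u {..<b}" "\<And>j. j < b \<Longrightarrow> u j ^ b = (\<Sum>i<b. a i * u j ^ i)"
  shows "x ^ b - (\<Sum>i<b. a i * x ^ i) = (\<Prod>j<b. x - u j)"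
proof -
  define p where "p = monom 1 b - (\<Sum>i<b. monom (a i) i)"
  define q where "q = (\<Prod>j<b. [:- u j, 1:])"
  have deg_q: "degree q = b"
    unfolding q_def by (subst degree_prod_sum_eq) auto
  have "p = q"
  proof (rule poly_eqI_degree_lead_coeff[where n = b and A = "u ` {..<b}"])
    have "coeff q b = lead_coeff q" by (simp add: deg_q)
    also have "\<dots> = 1" by (simp add: q_def lead_coeff_prod)
    finally show "coeff p b = coeff q b"
      by (simp add: p_def coeff_sum)
    show "card (u ` {..<b}) \<ge> b" using assms(1) by (simp add: card_image)
    show "degree p \<le> b"
      unfolding p_def
      by (intro degree_diff_le degree_sum_le degree_monom_le)
        (auto intro: order_trans[OF degree_monom_le])
    show "degree q \<le> b" by (simp add: deg_q)
    show "poly p y = poly q y" if "y \<in> u ` {..<b}" for y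
      using that assms(2) by (auto simp: p_def q_def poly_monom poly_sum poly_prod)
  qed
  then have "poly p x = poly q x" by simp
  then show ?thesis by (simp add: p_def q_def poly_monom poly_sum poly_prod)
qed

lemma roots_of_unity_inj:
  assumes "b \<ge> 1"
  shows "inj_on (\<lambda>j. exp (2 * of_real pi * \<i> / of_nat b) ^ j) {..<b}"
    and "(exp (2 * of_real pi * \<i> / of_nat b) ^ j) ^ b = 1"
proof -
  have exp: "exp (2 * of_real pi * \<i> / of_nat b) ^ j = cis (2 * pi * real j / real b)" for j
    by (simp add: cis_conv_exp mult_ac flip: exp_of_nat_mult)
  have bij: "bij_betw (\<lambda>k. cis (2 * pi * real k / real b)) {..<b} {z. z ^ b = 1}"
    using assms by (intro bij_betw_roots_unity) auto
  then show "inj_on (\<lambda>j. exp (2 * of_real pi * \<i> / of_nat b) ^ j) {..<b}"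
    unfolding exp by (rule bij_betw_imp_inj_on)
  show "(exp (2 * of_real pi * \<i> / of_nat b) ^ j) ^ b = 1"
  proof -
    have "exp (2 * of_real pi * \<i> / of_nat b) ^ b = (1 :: complex)"
      using assms by (simp add: exp_two_pi_i flip: exp_of_nat_mult)
    then show ?thesis by (metis mult.commute power_mult power_one)
  qed
qed

text \<open>The weights of a single block of length \<open>k\<close> by its number of keys; a block
  of length 0 does not exist.\<close>

definition block_poly :: "nat \<Rightarrow> nat \<Rightarrow> complex fps" where
  "block_poly b k = (case k of 0 \<Rightarrow> 0 | Suc k \<Rightarrow> fps_X ^ (b * k) * last_gf b k)"

text \<open>The series \<open>\<Sum>m. f\<^sub>m(z) (w \<sigma>) ^ (b m)\<close>.\<close>

definition bucket_series :: "nat \<Rightarrow> (nat \<Rightarrow> complex fps) \<Rightarrow> complex fps \<Rightarrow> fps3" where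
  "bucket_series b f \<sigma> = Abs_fps (\<lambda>n. Abs_fps (\<lambda>l.
     if b dvd l then fps_const (f (l div b) $ n) * \<sigma> ^ l else 0))"

text \<open>This is the specialization \<open>t = z w \<rho>\<close>, \<open>y = z\<close>. A block
  of length \<open>k\<close> gets \<open>z ^ (b * k)\<close> from \<open>t\<close> but has only
  \<open>k - 1\<close> full buckets, whence the extra factor \<open>fps_X ^ b\<close>.\<close>

lemma sum_kernel_coeff:
  assumes "b \<ge> 1"
  shows "(\<Sum>i<b. zw_series \<rho> (kernel_coeff b i) * fps_X ^ i) =
    fps_X ^ b * bucket_series b (block_poly b) \<rho>"
proof (rule fps_ext, rule fps_ext)
  fix n l
  have lhs: "(\<Sum>i<b. zw_series \<rho> (kernel_coeff b i) * fps_X ^ i) $ n $ l =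
      (\<Sum>i<b. if i \<le> n \<and> l = n - i then fps_const (kernel_coeff b i $ l) * \<rho> ^ l else 0)"
    by (auto simp: fps_sum_nth fps_X_power_mult_right_nth zw_series_nth_nth intro!: sum.cong)
  show "(\<Sum>i<b. zw_series \<rho> (kernel_coeff b i) * fps_X ^ i) $ n $ l =
      (fps_X ^ b * bucket_series b (block_poly b) \<rho>) $ n $ l"
  proof (cases rule: positive_multiple_cases[of l b])
    case (1 k)
    have kc: "kernel_coeff b i $ l = last_gf b k $ i" for i
      using 1 assms by (simp add: kernel_coeff_def del: mult_Suc_right)
    have "(\<Sum>i<b. if i \<le> n \<and> l = n - i then fps_const (kernel_coeff b i $ l) * \<rho> ^ l else 0) =
        (\<Sum>i<b. if i = n - l then if l \<le> n then fps_const (last_gf b k $ (n - l)) * \<rho> ^ l else 0 else 0)"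
      unfolding kc by (intro sum.cong refl) auto
    \<comment> \<open>If \<open>n - l\<close> lies outside the range of \<open>i\<close>, the
      coefficient of \<open>last_gf\<close> is 0 by the cutoff.\<close>
    also have "\<dots> = (if l \<le> n then fps_const (last_gf b k $ (n - l)) * \<rho> ^ l else 0)"
      by (auto simp: last_gf_nth)
    also have "\<dots> = (fps_X ^ b * bucket_series b (block_poly b) \<rho>) $ n $ l"
      using 1 assms by (auto simp: fps_X_power_mult_nth bucket_series_def block_poly_def)
    finally show ?thesis using lhs by simp
  next
    case 2
    then have "(\<Sum>i<b. if i \<le> n \<and> l = n - i then fps_const (kernel_coeff b i $ l) * \<rho> ^ l else 0) = 0"
      by (intro sum.neutral) (auto simp: kernel_coeff_def)
    moreover have "(fps_X ^ b * bucket_series b (block_poly b) \<rho>) $ n $ l = 0"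
      using 2 by (auto simp: fps_X_power_mult_nth bucket_series_def block_poly_def)
    ultimately show ?thesis using lhs by simp
  qed
qed

lemma fps3_divide_X: "f / fps_X = fps_shift 1 (f :: fps3)"
  by (rule fps_divide_X'[OF fps_inverse_one'[OF inverse_1, THEN fps_inverse_one']])

text \<open>The factored kernel polynomial is evaluated at \<open>z\<close>. Each root is divisible
  by \<open>z\<close>, so \<open>z ^ b\<close> cancels against the factor in
  \<open>sum_kernel_coeff\<close>.\<close>

lemma prod_tree_at:
  assumes "b \<ge> 1" "\<rho> \<noteq> 0"
  shows "(\<Prod>j<b. 1 - tree_at (const3 (exp (2 * of_real pi * \<i> / of_nat b) ^ j) * fps_X * fps_const fps_X *
      fps_const (fps_const \<rho>)) / fps_X) = 1 - bucket_series b (block_poly b) \<rho>"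
proof -
  define \<omega> where "\<omega> = exp (2 * of_real pi * \<i> / of_nat b)"
  define u where "u j = zw_series \<rho> (branch (\<omega> ^ j))" for j
  have inj: "inj_on u {..<b}"
    unfolding u_def inj_on_def
    using zw_series_branch_inj[OF assms(2)] roots_of_unity_inj(1)[OF assms(1)] \<omega>_def
    by (metis inj_onD)
  have root: "u j ^ b = (\<Sum>i<b. zw_series \<rho> (kernel_coeff b i) * u j ^ i)" for j
  proof -
    have "(\<omega> ^ j) ^ b = 1"
      unfolding \<omega>_def by (rule roots_of_unity_inj(2)[OF assms(1)])
    then have "branch (\<omega> ^ j) ^ b = (\<Sum>i<b. kernel_coeff b i * branch (\<omega> ^ j) ^ i)"
      by (intro kernel_root[OF assms(1)] branch_kernel) (simp_all add: branch_nth tree_series_0)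
    then show ?thesis
      unfolding u_def
      by (simp add: zw_series_sum zw_series_mult zw_series_power flip: zw_series_power[of _ _ b])
  qed
  have "u j $ 0 = 0" for j
    by (simp add: u_def zw_series_def branch_nth tree_series_0)
  then have "fps_X * (u j / fps_X) = u j" for j
    by (simp add: fps3_divide_X fps_eq_iff fps_X_mult_nth)
  then have "fps_X - u j = fps_X * (1 - u j / fps_X)" for j
    by (simp only: right_diff_distrib mult_1_right)
  then have "fps_X ^ b * (\<Prod>j<b. 1 - u j / fps_X) = (\<Prod>j<b. fps_X - u j)"
    by (simp only: prod.distrib prod_constant card_lessThan)
  also have "\<dots> = fps_X ^ b - (\<Sum>i<b. zw_series \<rho> (kernel_coeff b i) * fps_X ^ i)"
    by (rule monic_poly_eq_prod_roots[OF inj root, symmetric])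
  also have "\<dots> = fps_X ^ b * (1 - bucket_series b (block_poly b) \<rho>)"
    by (simp only: sum_kernel_coeff[OF assms(1)] right_diff_distrib mult_1_right)
  finally have "(\<Prod>j<b. 1 - u j / fps_X) = 1 - bucket_series b (block_poly b) \<rho>"
    by simp
  then show ?thesis by (simp only: u_def tree_at_eq \<omega>_def)
qed

section \<open>Products of bucket series and the block generating function\<close>

lemma bucket_series_mult:
  assumes "b \<ge> 1"
  shows "(bucket_series b f \<sigma> * bucket_series b g 1) $ n $ l = (if b dvd l
    then \<Sum>k\<le>l div b. fps_const ((f k * g (l div b - k)) $ n) * \<sigma> ^ (b * k) else 0)"
proof -
  define h where "h j = (\<Sum>i=0..n. bucket_series b f \<sigma> $ i $ j * bucket_series b g 1 $ (n - i) $ (l - j))" for j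
  have "(bucket_series b f \<sigma> * bucket_series b g 1) $ n $ l = (\<Sum>j=0..l. h j)"
    unfolding h_def by (simp add: fps_mult_nth fps_sum_nth) (rule sum.swap)
  also have "\<dots> = (if b dvd l
    then \<Sum>k\<le>l div b. fps_const ((f k * g (l div b - k)) $ n) * \<sigma> ^ (b * k) else 0)"
  proof (cases "b dvd l")
    case True
    then obtain m where l: "l = b * m" by (elim dvdE)
    have "(\<Sum>j=0..l. h j) = (\<Sum>j\<in>(*) b ` {..m}. h j)"
    proof (rule sum.mono_neutral_right)
      show "\<forall>j\<in>{0..l} - (*) b ` {..m}. h j = 0"
      proof
        fix j assume "j \<in> {0..l} - (*) b ` {..m}"
        then have "\<not> b dvd j" using assms l by (auto elim!: dvdE simp: image_iff)
        then show "h j = 0" by (simp add: h_def bucket_series_def)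
      qed
    qed (auto simp: l)
    also have "\<dots> = (\<Sum>k\<le>m. h (b * k))"
      using assms by (subst sum.reindex) (auto simp: inj_on_def)
    \<comment> \<open>Only the first factor carries \<open>\<sigma>\<close>; this later lets
      \<open>q\<close> mark the last block alone.\<close>
    also have "\<dots> = (\<Sum>k\<le>m. fps_const ((f k * g (m - k)) $ n) * \<sigma> ^ (b * k))"
    proof (intro sum.cong refl)
      fix k assume "k \<in> {..m}"
      have "h (b * k) = (\<Sum>i=0..n. fps_const (f k $ i * g (m - k) $ (n - i)) * \<sigma> ^ (b * k))"
        using assms unfolding h_def
        by (intro sum.cong refl) (simp add: bucket_series_def l mult_ac flip: right_diff_distrib' fps_const_mult)
      then show "h (b * k) = fps_const ((f k * g (m - k)) $ n) * \<sigma> ^ (b * k)"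
        by (simp add: fps_mult_nth fps_const_sum sum_distrib_right)
    qed
    finally show ?thesis using assms l by simp
  next
    case False
    have "h j = 0" if "j \<in> {0..l}" for j
      unfolding h_def
    proof (intro sum.neutral ballI)
      fix i
      have "\<not> b dvd j \<or> \<not> b dvd (l - j)"
        using that False dvd_add[of b j "l - j"] by auto
      then show "bucket_series b f \<sigma> $ i $ j * bucket_series b g 1 $ (n - i) $ (l - j) = 0"
        by (auto simp: bucket_series_def)
    qed
    then show ?thesis using False by simp
  qed
  finally show ?thesis .
qed

lemma open_gf_recurrence:
  "open_gf b m = (if m = 0 then 1 else 0) + (\<Sum>k\<le>m. block_poly b k * open_gf b (m - k))"
proof (cases m)
  case (Suc m')
  then show ?thesis
    unfolding Suc sum.atMost_Suc_shift
    by (simp add: open_gf_Suc block_poly_def del: sum.atMost_Suc)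
qed (simp add: open_gf_0 block_poly_def)

lemma open_series_eq:
  assumes "b \<ge> 1"
  shows "bucket_series b (open_gf b) 1 * (1 - bucket_series b (block_poly b) 1) = 1"
proof -
  have "bucket_series b (open_gf b) 1 = 1 + bucket_series b (block_poly b) 1 * bucket_series b (open_gf b) 1"
  proof (rule fps_ext, rule fps_ext)
    fix n l
    show "bucket_series b (open_gf b) 1 $ n $ l =
      (1 + bucket_series b (block_poly b) 1 * bucket_series b (open_gf b) 1) $ n $ l"
    proof (cases "b dvd l")
      case True
      then obtain m where l: "l = b * m" by (elim dvdE)
      have "bucket_series b (open_gf b) 1 $ n $ l = fps_const (open_gf b m $ n)"
        using assms by (simp add: bucket_series_def l)
      also have "\<dots> = (if m = 0 \<and> n = 0 then 1 else 0) +
          (\<Sum>k\<le>m. fps_const ((block_poly b k * open_gf b (m - k)) $ n))"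
        by (subst open_gf_recurrence) (simp add: fps_sum_nth fps_const_sum flip: fps_const_add)
      finally show ?thesis
        using assms by (simp add: bucket_series_mult l)
    next
      case False
      then show ?thesis using assms
        by (auto simp: bucket_series_mult) (auto simp: bucket_series_def)
    qed
  qed
  then show ?thesis by (simp add: algebra_simps)
qed

text \<open>Cutting off the last block, of length \<open>k\<close>, leaves an arbitrary open table
  with \<open>m - k\<close> buckets.\<close>

lemma block_count_eq:
  assumes "k \<le> m"
  shows "of_nat b ^ n * of_nat (block_count b m n k) / fact n = (block_poly b k * open_gf b (m - k)) $ n"
proof (cases k)
  case 0
  then show ?thesis by (simp add: block_count_0 block_poly_def)
next
  case (Suc k')
  then obtain m' where "m = Suc m'" "k' \<le> m'" using assms by (cases m) auto
  then show ?thesis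
    using Suc by (simp add: block_count_Suc block_weight_eq block_poly_def)
qed

lemma block_count_eq_0: "m < k \<Longrightarrow> block_count b m n k = 0"
  by (auto simp: block_count_def is_block_def)

lemma compose_X_power:
  fixes f :: "complex fps"
  assumes "b \<ge> 1" "\<And>k. M < k \<Longrightarrow> f $ k = 0"
  shows "f oo fps_X ^ b = (\<Sum>k\<le>M. fps_const (f $ k) * (fps_X ^ b) ^ k)"
proof -
  have 0: "(fps_X ^ b :: complex fps) $ 0 = 0" using assms(1) by simp
  have "f = (\<Sum>k\<le>M. fps_const (f $ k) * fps_X ^ k)"
    using assms(2) by (auto simp: fps_eq_iff fps_sum_nth if_distrib cong: if_cong)
  then have "f oo fps_X ^ b = (\<Sum>k\<le>M. fps_const (f $ k) * fps_X ^ k) oo fps_X ^ b" by simp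
  also have "\<dots> = (\<Sum>k\<le>M. fps_const (f $ k) * (fps_X ^ b) ^ k)"
    by (simp only: fps_compose_sum_distrib fps_compose_mult_distrib[OF 0] fps_const_compose
        fps_X_fps_compose_startby0[OF 0] flip: fps_compose_power[OF 0])
  finally show ?thesis .
qed

text \<open>Composition with \<open>of_nat b * fps_X\<close> supplies \<open>b ^ n\<close>. Blocks
  are no longer than the table, so each coefficient is a polynomial in \<open>q\<close>, and
  \<open>\<rho>\<close> enters only through \<open>\<rho> ^ (b * k) = q ^ k\<close>.\<close>

lemma block_gf_eq:
  assumes "b \<ge> 1" "\<rho> ^ b = fps_X ^ b"
  shows "subst_q (block_gf b oo (of_nat b * fps_X)) (fps_X ^ b) =
    bucket_series b (block_poly b) \<rho> * bucket_series b (open_gf b) 1"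
proof (rule fps_ext, rule fps_ext)
  fix n l
  define f where "f = (block_gf b oo (of_nat b * fps_X)) $ n $ l"
  have f: "f $ k = (if b dvd l then of_nat b ^ n * of_nat (block_count b (l div b) n k) / fact n else 0)" for k
    unfolding f_def fps_of_nat[symmetric] fps_compose_linear
    by (simp add: block_gf_def)
  have "subst_q (block_gf b oo (of_nat b * fps_X)) (fps_X ^ b) $ n $ l = f oo fps_X ^ b"
    by (simp add: subst_q_def f_def)
  also have "\<dots> = (\<Sum>k\<le>l div b. fps_const (f $ k) * (fps_X ^ b) ^ k)"
    using assms(1) by (rule compose_X_power) (simp add: f block_count_eq_0)
  also have "\<dots> = (bucket_series b (block_poly b) \<rho> * bucket_series b (open_gf b) 1) $ n $ l"
    by (auto simp: bucket_series_mult[OF assms(1)] f block_count_eq power_mult assms(2) intro!: sum.cong)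
  finally show "subst_q (block_gf b oo (of_nat b * fps_X)) (fps_X ^ b) $ n $ l =
    (bucket_series b (block_poly b) \<rho> * bucket_series b (open_gf b) 1) $ n $ l" .
qed

theorem theorem10p1:
  fixes b :: nat and q \<rho> :: "complex fps" and \<omega> :: complex and z w r :: fps3
  defines "\<omega> \<equiv> exp (2 * of_real pi * \<i> / of_nat b)"
    and "z \<equiv> fps_X"
    and "w \<equiv> fps_const fps_X"
    and "q \<equiv> fps_X ^ b"
    and "r \<equiv> fps_const (fps_const \<rho>)"
  assumes "b \<ge> 1" and "\<rho> ^ b = q"
  shows "subst_q (block_gf b oo (of_nat b * z)) q =
    (1 - (\<Prod>j<b. 1 - tree_at (const3 (\<omega> ^ j) * z * w * r) / z)) /
    (\<Prod>j<b. 1 - tree_at (const3 (\<omega> ^ j) * z * w) / z)"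
proof -
  let ?L = "bucket_series b (block_poly b)" and ?N = "bucket_series b (open_gf b) 1"
  have "\<rho> \<noteq> 0" using assms(6,7) by (auto simp: q_def power_0_left)
  then have num: "1 - (\<Prod>j<b. 1 - tree_at (const3 (\<omega> ^ j) * z * w * r) / z) = ?L \<rho>"
    using prod_tree_at[OF \<open>b \<ge> 1\<close>, of \<rho>] by (simp add: \<omega>_def z_def w_def r_def)
  \<comment> \<open>The denominator is the same product at \<open>\<rho> = 1\<close>.\<close>
  have den: "(\<Prod>j<b. 1 - tree_at (const3 (\<omega> ^ j) * z * w) / z) = 1 - ?L 1"
    using prod_tree_at[OF \<open>b \<ge> 1\<close>, of 1] by (simp add: \<omega>_def z_def w_def)
  have N: "?N * (1 - ?L 1) = 1" by (rule open_series_eq[OF \<open>b \<ge> 1\<close>])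
  \<comment> \<open>There is no block of length 0, so the constant term is 1 and the division is the
    true quotient.\<close>
  have "(1 - ?L 1) $ 0 $ 0 $ 0 \<noteq> 0"
    by (simp add: bucket_series_def block_poly_def)
  then have "?L \<rho> / (1 - ?L 1) * (1 - ?L 1) = ?L \<rho>"
    by (rule fps3_divide_mult)
  then have "?L \<rho> / (1 - ?L 1) * ((1 - ?L 1) * ?N) = ?L \<rho> * ?N"
    by (simp only: mult.assoc[symmetric])
  then have "?L \<rho> / (1 - ?L 1) = ?L \<rho> * ?N"
    using N by (simp add: mult.commute)
  moreover have "subst_q (block_gf b oo (of_nat b * z)) q = ?L \<rho> * ?N"
    unfolding z_def q_def by (rule block_gf_eq) (use assms(6,7) in \<open>simp_all add: q_def\<close>)
  ultimately show ?thesis by (simp only: num den)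
qed

end
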